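(* Let $W$ be a nonnegative random variable with mean $\mu$ and variance $\sigma^2\in(0,\infty)$. Let $W^s$ have the $W$-size biased distribution and $W^z$ the $W$-zero biased distribution. Put $\alpha=\mu/\sigma^2$, $r=\mu^2/\sigma^2$ and $\Theta:=d_{\mathrm W}(\mathscr{L}(W^s),\mathscr{L}(W^z))$. Then $$d_{\mathrm W}(\mathscr{L}(W),\Gamma(r,\alpha))\le 8\sqrt{\frac{3\mu}{r+2}}\,\Theta^{1/2}+\frac{8r}{r+2}\Theta,$$ $$d_{\mathrm K}(\mathscr{L}(W),\Gamma(r,\alpha))\le a_{r,\alpha}\,\Theta^{\frac{r\wedge 1}{r\wedge 1+2}}+b_{r,\alpha}\,\Theta^{\frac{r\wedge 1+1}{r\wedge 1+2}},$$ where $$a_{r,\alpha}=\begin{cases}\left(\frac12+\frac1r\right)\left(\frac{48\mu}{r+2}\right)^{\frac{r}{r+2}}\left[\frac{\alpha^r}{\Gamma(r)}\right]^{\frac{2}{r+2}},&0<r<1,\\[4pt] 3\left(\frac{6\mu}{r+2}\right)^{1/3}\left[\frac{\alpha}{\Gamma(r)}\left(\frac{r-1}{e}\right)^{r-1}\right]^{2/3},&r\ge1,\end{cases}$$ $$b_{r,\alpha}=\begin{cases}8\alpha\left(\frac{\mu}{r+2}\right)^{\frac{r+1}{r+2}}\left[\frac{\alpha^r}{48\,\Gamma(r)}\right]^{\frac{1}{r+2}},&0<r<1,\\[4pt] 4\alpha\left(\frac{\mu}{r+2}\right)^{2/3}\left[\frac{\alpha}{6\,\Gamma(r)}\left(\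frac{r-1}{e}\right)^{r-1}\right]^{1/3},&r\ge1.\end{cases}$$
   Context: $\mathscr{L}(X)$ is the law of $X$; $a\wedge b=\min(a,b)$; $0^0=1$. $\Gamma(r,\alpha)$ is the distribution with density $\frac{1}{\Gamma(r)}\alpha^r x^{r-1}e^{-\alpha x}$, $x>0$. $d_{\mathrm W}(\mathscr{L}(X),\mathscr{L}(Y))=\sup_{f}|\mathbb{E}f(X)-\mathbb{E}f(Y)|$ over all $f:\mathbb{R}\to\mathbb{R}$ with $|f(x)-f(y)|\le|x-y|$ for all $x,y\in\mathbb{R}$ (understood as $+\infty$ if exactly one of the laws has infinite first absolute moment, in which case bounds in terms of it are trivial). $d_{\mathrm K}(\mathscr{L}(X),\mathscr{L}(Y))=\sup_{z\in\mathbb{R}}|\mathbb{P}(X\le z)-\mathbb{P}(Y\le z)|$. Size bias: for a nonnegative random variable $V$ with finite mean $\mu>0$, $V^s$ has the $V$-size biased distribution if $\mathbb{E}[Vf(V)]=\mu\,\mathbb{E}f(V^s)$ for all functions $f$ with $\mathbb{E}|Vf(V)|<\infty$. Zero bias: for a random variable $W$ with mean $\mu$ and variance $\sigma^2\in(0,\infty)$, $W^z$ has the $W$-zero biased distribution if $\mathbb{E}[(W-\mu)f(W)]=\sigma^2\,\mathbb{E}f'(W^z)$ for all differentiable functions $f$ with $\mathbb{E}|Wf(W)|<\infty$ and for which $\mathbb{E}|f'(W^z)|<\infty$. *)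

theory Defs
  imports "HOL-Probability.Probability"
begin

text \<open>Both distances take extended values. When exactly one of the two laws has infinite first
  absolute moment the Wasserstein distance is infinite. When both moments are finite, every
  1-Lipschitz \<open>f\<close> is integrable, so the integrability conditions under the supremum are vacuous;
  they matter only when both moments are infinite, where they keep the value \<open>0\<close> of the integral of
  a non-integrable function out of the supremum.\<close>

definition wasserstein_dist :: "real measure \<Rightarrow> real measure \<Rightarrow> ennreal" where
  "wasserstein_dist P Q =
     (if integrable P (\<lambda>x. x) \<longleftrightarrow> integrable Q (\<lambda>x. x)
      then (SUP f \<in> {f :: real \<Rightarrow> real. 1-lipschitz_on UNIV f \<and> integrable P f \<and> integrable Q f}.
              ennreal \<bar>(\<integral>x. f x \<partial>P) - (\<integral>x. f x \<partial>Q)\<bar>)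
      else \<infinity>)"

definition kolmogorov_dist :: "real measure \<Rightarrow> real measure \<Rightarrow> ennreal" where
  "kolmogorov_dist P Q = (SUP z. ennreal \<bar>cdf P z - cdf Q z\<bar>)"

text \<open>\<open>Gamma_law r \<alpha>\<close> has shape \<open>r\<close> and rate \<open>\<alpha>\<close>.\<close>

definition Gamma_law :: "real \<Rightarrow> real \<Rightarrow> real measure" where
  "Gamma_law r \<alpha> = density lborel
     (\<lambda>x. ennreal (if x > 0 then 1 / Gamma r * \<alpha> powr r * x powr (r - 1) * exp (- \<alpha> * x) else 0))"

text \<open>\<open>Vs\<close>, possibly on another probability space, has the \<open>V\<close>-size biased distribution. The test
  functions are Borel measurable, and the identity includes that the expectation of \<open>f \<circ> Vs\<close>
  exists.\<close>

definition size_biased ::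
    "'a measure \<Rightarrow> ('a \<Rightarrow> real) \<Rightarrow> 'b measure \<Rightarrow> ('b \<Rightarrow> real) \<Rightarrow> bool" where
  "size_biased M V N Vs \<longleftrightarrow>
     (\<forall>f \<in> borel_measurable borel. integrable M (\<lambda>\<omega>. V \<omega> * f (V \<omega>)) \<longrightarrow>
        integrable N (\<lambda>\<omega>. f (Vs \<omega>)) \<and>
        (\<integral>\<omega>. V \<omega> * f (V \<omega>) \<partial>M) = (\<integral>\<omega>. V \<omega> \<partial>M) * (\<integral>\<omega>. f (Vs \<omega>) \<partial>N))"

definition zero_biased ::
    "'a measure \<Rightarrow> ('a \<Rightarrow> real) \<Rightarrow> 'b measure \<Rightarrow> ('b \<Rightarrow> real) \<Rightarrow> bool" where
  "zero_biased M W N Wz \<longleftrightarrow>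
     (\<forall>f :: real \<Rightarrow> real. f differentiable_on UNIV \<longrightarrow> integrable M (\<lambda>\<omega>. W \<omega> * f (W \<omega>)) \<longrightarrow>
        integrable N (\<lambda>\<omega>. deriv f (Wz \<omega>)) \<longrightarrow>
        (\<integral>\<omega>. (W \<omega> - (\<integral>\<omega>'. W \<omega>' \<partial>M)) * f (W \<omega>) \<partial>M)
          = prob_space.variance M W * (\<integral>\<omega>. deriv f (Wz \<omega>) \<partial>N))"

text \<open>Powers with exponent \<open>p > 0\<close> of extended nonnegative numbers.\<close>

definition ennreal_powr :: "ennreal \<Rightarrow> real \<Rightarrow> ennreal" where
  "ennreal_powr x p = (if x = \<infinity> then \<infinity> else ennreal (enn2real x powr p))"

text \<open>The real power with the convention \<open>0\<^sup>0 = 1\<close>; in contrast, \<open>0 powr 0 = 0\<close>.\<close>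

definition powr0 :: "real \<Rightarrow> real \<Rightarrow> real" where
  "powr0 x p = (if x = 0 \<and> p = 0 then 1 else x powr p)"

definition coeff_a :: "real \<Rightarrow> real \<Rightarrow> real \<Rightarrow> real" where
  "coeff_a \<mu> r \<alpha> =
     (if r < 1
      then (1/2 + 1/r) * (48 * \<mu> / (r + 2)) powr (r / (r + 2))
             * (\<alpha> powr r / Gamma r) powr (2 / (r + 2))
      else 3 * (6 * \<mu> / (r + 2)) powr (1/3)
             * (\<alpha> / Gamma r * powr0 ((r - 1) / exp 1) (r - 1)) powr (2/3))"

definition coeff_b :: "real \<Rightarrow> real \<Rightarrow> real \<Rightarrow> real" where
  "coeff_b \<mu> r \<alpha> =
     (if r < 1
      then 8 * \<alpha> * (\<mu> / (r + 2)) powr ((r + 1) / (r + 2))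
             * (\<alpha> powr r / (48 * Gamma r)) powr (1 / (r + 2))
      else 4 * \<alpha> * (\<mu> / (r + 2)) powr (2/3)
             * (\<alpha> / (6 * Gamma r) * powr0 ((r - 1) / exp 1) (r - 1)) powr (1/3))"

end

theory Submission
  imports Defs "HOL-Real_Asymp.Real_Asymp"
begin

text \<open>
  The gamma law is characterized by the Stein equation \<open>x f' + (r - \<alpha> x) f = h - E h\<close>. Inserting
  \<open>W\<close> and using \<open>E[W f'(W)] = \<mu> E f'(W\<^sup>s)\<close> and \<open>E[(r - \<alpha> W) f(W)] = - \<mu> E f'(W\<^sup>z)\<close> shows that
  the expectations of \<open>h\<close> differ by \<open>\<mu> (E f'(W\<^sup>s) - E f'(W\<^sup>z))\<close>, which is at most \<open>\<mu> \<Theta>\<close> times the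
  Lipschitz constant of \<open>f'\<close>.

  For that constant, \<open>|f''| \<le> (2 |h''| + 4 \<alpha> |h'|) / (r + 2)\<close> in supremum norms: differentiating the
  equation and applying the maximum principle gives \<open>\<alpha> |f| \<le> |h'|\<close> and \<open>2 \<alpha> |f'| \<le> |h''|\<close>. The once
  and twice differentiated equations, read as first order equations for \<open>f'\<close> and \<open>f''\<close>, then give
  \<open>|x f''| \<le> 4 |h'|\<close> and \<open>|(r + 2 - \<alpha> x) f''| \<le> 2 |h''|\<close>; multiply the former by \<open>\<alpha>\<close> and add.

  Lipschitz functions and indicators of half-lines are smoothed by averaging twice over a short
  window, whose length is optimized; for indicators the error is controlled by the
  gamma probability of short intervals.
\<close>

section \<open>Maximum principle and first order estimates\<close>

text \<open>Each differentiation of the Stein equation raises the shape by one and adds \<alpha> to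
  the coefficient of the zero order term, which is how \<open>r + 2\<close> arises. Neither final
  estimate controls \<open>f''\<close> alone: the one for \<open>x * f''\<close> degenerates at
  \<open>0\<close>, the other at \<open>x = (r + 2) / \<alpha>\<close>. Their weights
  \<open>\<alpha> * x\<close> and \<open>r + 2 - \<alpha> * x\<close> add up to a constant, so the
  sum is uniform in \<open>x\<close>. The maximum principle and the first order estimates presuppose
  some bound on the function they are applied to. The homogeneous equation has the solution
  \<open>x powr (- r) * exp (\<alpha> * x)\<close>, unbounded at both ends, so a solution that is
  regular at \<open>0\<close> and bounded at infinity has to be singled out: integrating from
  \<open>0\<close> settles the first, the centering \<open>h - E h\<close> the second. For
  \<open>r < 1\<close> the gamma density is unbounded at \<open>0\<close>, and an interval of length
  \<open>w\<close> may have probability of order \<open>w powr r\<close> rather than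
  \<open>w\<close>; this is the origin of \<open>min r 1\<close> in the exponents.\<close>

lemma second_derivative_nonpos_at_max:
  fixes w w' :: "real \<Rightarrow> real"
  assumes "a < m"
    and d1: "\<And>x. x > a \<Longrightarrow> (w has_real_derivative w' x) (at x)"
    and d2: "(w' has_real_derivative D) (at m)"
    and max: "\<And>x. x > a \<Longrightarrow> w x \<le> w m"
  shows "w' m = 0" "D \<le> 0"
proof -
  show w'm: "w' m = 0"
    by (rule DERIV_local_max[OF d1[OF \<open>a < m\<close>], of "m - a"]) (use \<open>a < m\<close> max in auto)
  show "D \<le> 0"
  proof (rule ccontr)
    assume "\<not> D \<le> 0"
    \<comment> \<open>\<open>w'\<close> is differentiable only at \<open>m\<close>. Since
      \<open>w' m = 0\<close>, a positive derivative there already makes \<open>w'\<close> positive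
      just to the right of \<open>m\<close>, so \<open>w\<close> would rise above its
      maximum.\<close>
    then obtain d where d: "d > 0" "\<And>h. h > 0 \<Longrightarrow> h < d \<Longrightarrow> w' m < w' (m + h)"
      using has_real_derivative_pos_inc_right[OF d2] by auto
    have "w m < w (m + d/2)"
    proof (rule DERIV_pos_imp_increasing_open[where f = w])
      show "\<exists>y. DERIV w x :> y \<and> 0 < y" if "m < x" "x < m + d / 2" for x
        using d1[of x] d(2)[of "x - m"] that \<open>a < m\<close> \<open>d > 0\<close> w'm
        by (intro exI[of _ "w' x"]) auto
      show "continuous_on {m..m + d / 2} w"
        by (rule DERIV_continuous_on[where D = w']) (use d1 \<open>a < m\<close> in \<open>auto intro: has_field_derivative_at_within\<close>)
    qed (use d in auto)
    with max[of "m + d/2"] \<open>a < m\<close> \<open>d > 0\<close> show False by auto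
  qed
qed

lemma attains_max_on_Ioi:
  fixes w :: "real \<Rightarrow> real"
  assumes c: "continuous_on {0<..} w"
    and l0: "filterlim w at_bot (at_right 0)" and l1: "filterlim w at_bot at_top"
  obtains m where "m > 0" "\<And>x. x > 0 \<Longrightarrow> w x \<le> w m"
proof -
  have "eventually (\<lambda>x. w x \<le> w 1) (at_right 0)" "eventually (\<lambda>x. w x \<le> w 1) at_top"
    using l0 l1 unfolding filterlim_at_bot by auto
  then obtain a b where a: "a > 0" "\<And>x. x > 0 \<Longrightarrow> x < a \<Longrightarrow> w x \<le> w 1"
    and b: "\<And>x. x \<ge> b \<Longrightarrow> w x \<le> w 1"
    unfolding eventually_at_right_field eventually_at_top_linorder by auto
  let ?I = "{min a 1..max b 1}"
  have "continuous_on ?I w" by (rule continuous_on_subset[OF c]) (use \<open>a > 0\<close> in auto)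
  then obtain m where m: "m \<in> ?I" "\<And>x. x \<in> ?I \<Longrightarrow> w x \<le> w m"
    using continuous_attains_sup[of ?I w] by force
  show ?thesis
  proof (rule that[of m])
    show "m > 0" using m(1) \<open>a > 0\<close> by auto
    have 1: "w 1 \<le> w m" by (rule m(2)) auto
    show "w x \<le> w m" if "x > 0" for x
    proof (cases "x \<in> ?I")
      case False
      then have "w x \<le> w 1" using a b that by force
      with 1 show ?thesis by simp
    qed (use m in auto)
  qed
qed

text \<open>Subtracting a small multiple of \<open>x + c - ln x\<close> forces an interior maximum,
  whatever the behaviour of \<open>u\<close> at \<open>0\<close> and \<open>\<infinity>\<close>; \<open>c\<close> is chosen to keep the sign of the equation.\<close>

lemma gamma_max_principle_upper:
  fixes u u' u'' g :: "real \<Rightarrow> real"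
  assumes "s \<ge> 1" "\<alpha> > 0" "\<beta> > 0"
    and d1: "\<And>x. x > 0 \<Longrightarrow> (u has_real_derivative u' x) (at x)"
    and d2: "\<And>x. x > 0 \<Longrightarrow> (u' has_real_derivative u'' x) (at x)"
    and ode: "\<And>x. x > 0 \<Longrightarrow> x * u'' x + (s - \<alpha> * x) * u' x - \<beta> * u x = g x"
    and bd: "\<And>x. x > 0 \<Longrightarrow> \<bar>u x\<bar> \<le> C"
    and g: "\<And>x. x > 0 \<Longrightarrow> - G \<le> g x"
    and "x > 0"
  shows "\<beta> * u x \<le> G"
proof -
  define c where "c = (\<alpha> + s) / \<beta>"
  have main: "u x \<le> G / \<beta> + \<delta> * (x + c - ln x)" if "\<delta> > 0" for \<delta>
  proof -
    define w where "w = (\<lambda>t. u t + \<delta> * (ln t - t - c))"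
    define w' where "w' = (\<lambda>t. u' t + \<delta> * (1 / t - 1))"
    have dw: "(w has_real_derivative w' t) (at t)" if "t > 0" for t
      unfolding w_def w'_def using that by (auto intro!: derivative_eq_intros d1)
    have dw': "(w' has_real_derivative u'' t - \<delta> / t\<^sup>2) (at t)" if "t > 0" for t
      unfolding w'_def using that
      by (auto intro!: derivative_eq_intros d2 simp: power2_eq_square)
    have cont: "continuous_on {0<..} w"
      by (rule DERIV_continuous_on) (use dw in \<open>auto intro: has_field_derivative_at_within\<close>)
    have "filterlim (\<lambda>t. C + \<delta> * (ln t - t - c)) at_bot (at_right 0)"
      using \<open>\<delta> > 0\<close> by real_asymp
    then have l0: "filterlim w at_bot (at_right 0)"
      by (rule filterlim_at_bot_mono)
        (auto simp: eventually_at_right_field w_def abs_le_iff intro!: exI[of _ 1] dest!: bd)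
    have "filterlim (\<lambda>t. C + \<delta> * (ln t - t - c)) at_bot at_top"
      using \<open>\<delta> > 0\<close> by real_asymp
    then have l1: "filterlim w at_bot at_top"
      by (rule filterlim_at_bot_mono)
        (auto simp: eventually_at_top_dense w_def abs_le_iff intro!: exI[of _ 0] dest!: bd)
    obtain m where m: "m > 0" "\<And>t. t > 0 \<Longrightarrow> w t \<le> w m"
      using attains_max_on_Ioi[OF cont l0 l1] by blast
    note crit = second_derivative_nonpos_at_max[OF \<open>m > 0\<close> dw dw'[OF \<open>m > 0\<close>] m(2)]
    have u': "u' m = \<delta> * (1 - 1 / m)" using crit(1) by (simp add: w'_def algebra_simps)
    have "m * u'' m \<le> m * (\<delta> / m\<^sup>2)" using crit(2) \<open>m > 0\<close> by (intro mult_left_mono) auto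
    then have u'': "m * u'' m \<le> \<delta> / m" using \<open>m > 0\<close> by (simp add: power2_eq_square)
    have "\<beta> * u m = m * u'' m + (s - \<alpha> * m) * u' m - g m" using ode[OF \<open>m > 0\<close>] by simp
    also have "\<dots> \<le> \<delta> / m + (s - \<alpha> * m) * (\<delta> * (1 - 1 / m)) + G"
      using u'' g[OF \<open>m > 0\<close>] u' by simp
    also have "\<dots> = G + \<delta> * (s + \<alpha> - \<alpha> * m - (s - 1) / m)"
      using \<open>m > 0\<close> by (simp add: field_simps)
    \<comment> \<open>Here \<open>s \<ge> 1\<close> enters: the second derivative of
      \<open>ln\<close> costs \<open>\<delta> / m\<close>, which the drift compensates by
      \<open>- \<delta> * s / m\<close>. What is left, \<open>s + \<alpha> = \<beta> * c\<close>, is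
      removed by the shift by \<open>c\<close>.\<close>
    also have "\<dots> \<le> G + \<delta> * (s + \<alpha>)"
      using assms(1-3) \<open>m > 0\<close> \<open>\<delta> > 0\<close>
      by (intro add_left_mono mult_left_mono) (auto intro: order_trans[of _ 0])
    finally have "u m \<le> G / \<beta> + \<delta> * c"
      using \<open>\<beta> > 0\<close> by (simp add: c_def field_simps)
    moreover have "\<delta> * (ln m - m) \<le> 0"
      using ln_bound[OF \<open>m > 0\<close>] \<open>\<delta> > 0\<close> by (simp add: mult_nonneg_nonpos)
    ultimately have "w m \<le> G / \<beta>" by (simp add: w_def algebra_simps)
    with m(2)[OF \<open>x > 0\<close>] show ?thesis by (simp add: w_def algebra_simps)
  qed
  have "((\<lambda>\<delta>. G / \<beta> + \<delta> * (x + c - ln x)) \<longlongrightarrow> G / \<beta> + 0 * (x + c - ln x)) (at_right 0)"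
    by (intro tendsto_intros)
  then have "u x \<le> G / \<beta> + 0 * (x + c - ln x)"
    by (rule tendsto_lowerbound)
       (use main in \<open>auto simp: eventually_at_right_field intro!: exI[of _ 1]\<close>)
  then show ?thesis using \<open>\<beta> > 0\<close> by (simp add: field_simps)
qed

lemma gamma_max_principle:
  fixes u u' u'' g :: "real \<Rightarrow> real"
  assumes "s \<ge> 1" "\<alpha> > 0" "\<beta> > 0"
    and d1: "\<And>x. x > 0 \<Longrightarrow> (u has_real_derivative u' x) (at x)"
    and d2: "\<And>x. x > 0 \<Longrightarrow> (u' has_real_derivative u'' x) (at x)"
    and ode: "\<And>x. x > 0 \<Longrightarrow> x * u'' x + (s - \<alpha> * x) * u' x - \<beta> * u x = g x"
    and bd: "\<And>x. x > 0 \<Longrightarrow> \<bar>u x\<bar> \<le> C"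
    and g: "\<And>x. x > 0 \<Longrightarrow> \<bar>g x\<bar> \<le> G"
    and "x > 0"
  shows "\<beta> * \<bar>u x\<bar> \<le> G"
proof -
  have "\<beta> * u x \<le> G"
    by (rule gamma_max_principle_upper[OF assms(1-3) d1 d2 ode bd _ \<open>x > 0\<close>])
       (use g in \<open>force simp: abs_le_iff\<close>)+
  moreover have "\<beta> * (- u x) \<le> G"
  proof (rule gamma_max_principle_upper[OF assms(1-3), where u = "\<lambda>x. - u x" and u' = "\<lambda>x. - u' x"
        and u'' = "\<lambda>x. - u'' x" and g = "\<lambda>x. - g x" and C = C])
    show "t * - u'' t + (s - \<alpha> * t) * - u' t - \<beta> * - u t = - g t" if "t > 0" for t
      using ode[OF that] by (simp add: algebra_simps)
  qed (use g bd \<open>x > 0\<close> in \<open>auto intro!: derivative_eq_intros d1 d2 simp: abs_le_iff\<close>)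
  ultimately show ?thesis by (simp add: abs_if)
qed

section \<open>Integrating factors for first order equations\<close>

lemma gamma_weight_deriv:
  fixes x :: real assumes "x > 0"
  shows "((\<lambda>x. x powr s * exp (- \<alpha> * x)) has_real_derivative
           x powr (s - 1) * exp (- \<alpha> * x) * (s - \<alpha> * x)) (at x)"
proof -
  have "x powr s = x powr (s - 1) * x" using assms by (simp add: powr_diff)
  then show ?thesis
    using assms by (auto intro!: derivative_eq_intros simp: field_simps powr_diff)
qed

text \<open>\<open>x powr s * exp (- \<alpha> * x)\<close> is the integrating factor of the operator
  \<open>x * u' + (s - \<alpha> * x) * u\<close>. The comparison arguments below apply it to a
  constant minus a multiple of the solution and read off monotonicity from the sign of the
  derivative.\<close>

lemma gamma_weight_deriv_mult:
  fixes x :: real assumes "x > 0" and d: "(u has_real_derivative u') (at x)"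
  shows "((\<lambda>x. x powr s * exp (- \<alpha> * x) * u x) has_real_derivative
           x powr (s - 1) * exp (- \<alpha> * x) * (x * u' + (s - \<alpha> * x) * u x)) (at x)"
proof -
  have "x powr s = x powr (s - 1) * x" using assms by (simp add: powr_diff)
  then show ?thesis
    by (intro DERIV_cong[OF DERIV_mult[OF gamma_weight_deriv[OF \<open>x > 0\<close>] d]])
       (simp add: algebra_simps)
qed

text \<open>With \<open>s - \<alpha> * x\<close> frozen as \<open>k\<close>, the weighted difference
  \<open>Q\<close> of \<open>G\<close> and \<open>k * u\<close> is monotone on the side of
  \<open>x\<close> where \<open>s - \<alpha> * t\<close> has the sign of \<open>k\<close> and at
  least its modulus: to the left if \<open>k \<ge> 0\<close>, to the right if \<open>k < 0\<close>.
  At the end of that side the weight kills the bounded \<open>u\<close>, so \<open>Q\<close> tends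
  to \<open>0\<close> there and \<open>Q x \<ge> 0\<close>.\<close>

lemma gamma_first_order_bound_upper:
  fixes u u' g :: "real \<Rightarrow> real"
  assumes "s > 0" "\<alpha> > 0"
    and d: "\<And>x. x > 0 \<Longrightarrow> (u has_real_derivative u' x) (at x)"
    and ode: "\<And>x. x > 0 \<Longrightarrow> x * u' x + (s - \<alpha> * x) * u x = g x"
    and bd: "\<And>x. x > 0 \<Longrightarrow> \<bar>u x\<bar> \<le> C"
    and g: "\<And>x. x > 0 \<Longrightarrow> \<bar>g x\<bar> \<le> G"
    and "x > 0"
  shows "(s - \<alpha> * x) * u x \<le> G"
proof -
  have G0: "G \<ge> 0" and C0: "C \<ge> 0" using g[of 1] bd[of 1] by auto
  define k where "k = s - \<alpha> * x"
  define E where "E = (\<lambda>t. t powr s * exp (- \<alpha> * t))"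
  define Q where "Q = (\<lambda>t. E t * (G - k * u t))"
  define q where "q = (\<lambda>t. t powr (s - 1) * exp (- \<alpha> * t) * (G * (s - \<alpha> * t) - k * g t))"
  have dQ: "(Q has_real_derivative q t) (at t)" if "t > 0" for t
    using that unfolding Q_def E_def q_def
    by (intro DERIV_cong[OF gamma_weight_deriv_mult[where u' = "- k * u' t"]])
       (auto intro!: derivative_eq_intros d simp: algebra_simps simp flip: ode[OF that])
  have kg: "\<bar>k * g t\<bar> \<le> \<bar>k\<bar> * G" if "t > 0" for t
    using g[OF that] by (simp add: abs_mult mult_left_mono)
  have boundQ: "norm (Q t) \<le> norm (E t) * (G + \<bar>k\<bar> * C)" if "t > 0" for t
  proof -
    have "\<bar>k * u t\<bar> \<le> \<bar>k\<bar> * C" using bd[OF that] by (simp add: abs_mult mult_left_mono)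
    then have "\<bar>G - k * u t\<bar> \<le> G + \<bar>k\<bar> * C" using G0 by linarith
    then show ?thesis by (simp add: Q_def abs_mult mult_left_mono)
  qed
  have "Q x \<ge> 0"
  proof (cases "k \<ge> 0")
    case True
    have "q t \<ge> 0" if "t > 0" "t \<le> x" for t
    proof -
      have "k * G \<le> (s - \<alpha> * t) * G"
        using that \<open>\<alpha> > 0\<close> G0 unfolding k_def by (intro mult_right_mono) auto
      then have "G * (s - \<alpha> * t) - k * g t \<ge> 0" using kg[OF that(1)] True by (simp add: abs_le_iff mult.commute)
      then show ?thesis unfolding q_def by simp
    qed
    then have mono: "Q t \<le> Q x" if "t > 0" "t \<le> x" for t
      using that by (intro DERIV_nonneg_imp_nondecreasing[of t x Q]) (auto intro!: exI dQ)
    have "(E \<longlongrightarrow> 0) (at_right 0)" unfolding E_def using \<open>s > 0\<close> by real_asymp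
    then have "((\<lambda>t. norm (E t) * (G + \<bar>k\<bar> * C)) \<longlongrightarrow> 0) (at_right 0)"
      by (intro tendsto_mult_left_zero tendsto_norm_zero)
    then have "(Q \<longlongrightarrow> 0) (at_right 0)"
      by (rule Lim_null_comparison[rotated])
         (auto simp: eventually_at_right_field simp del: real_norm_def intro!: exI[of _ 1] boundQ)
    then show ?thesis
      by (rule tendsto_upperbound)
         (use mono \<open>x > 0\<close> in \<open>auto simp: eventually_at_right_field intro!: exI[of _ x]\<close>)
  next
    case False
    have "q t \<le> 0" if "t \<ge> x" for t
    proof -
      have "\<bar>k\<bar> * G \<le> (\<alpha> * t - s) * G"
        using that \<open>\<alpha> > 0\<close> G0 False unfolding k_def by (intro mult_right_mono) auto
      then have "G * (s - \<alpha> * t) - k * g t \<le> 0"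
        using kg[of t] that \<open>x > 0\<close> by (simp add: abs_le_iff algebra_simps)
      then show ?thesis unfolding q_def by (simp add: mult_nonneg_nonpos)
    qed
    then have mono: "Q t \<le> Q x" if "t \<ge> x" for t
      using that \<open>x > 0\<close> by (intro DERIV_nonpos_imp_nonincreasing[of x t Q]) (auto intro!: exI dQ)
    have "(E \<longlongrightarrow> 0) at_top" unfolding E_def using \<open>\<alpha> > 0\<close> by real_asymp
    then have "((\<lambda>t. norm (E t) * (G + \<bar>k\<bar> * C)) \<longlongrightarrow> 0) at_top"
      by (intro tendsto_mult_left_zero tendsto_norm_zero)
    then have "(Q \<longlongrightarrow> 0) at_top"
      by (rule Lim_null_comparison[rotated])
         (auto simp: eventually_at_top_dense simp del: real_norm_def intro!: exI[of _ 0] boundQ)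
    then show ?thesis
      by (rule tendsto_upperbound)
         (use mono in \<open>auto simp: eventually_at_top_linorder intro!: exI[of _ x]\<close>)
  qed
  moreover have "E x > 0" using \<open>x > 0\<close> by (simp add: E_def)
  ultimately show ?thesis by (simp add: Q_def k_def zero_le_mult_iff)
qed

lemma gamma_first_order_bound:
  fixes u u' g :: "real \<Rightarrow> real"
  assumes "s > 0" "\<alpha> > 0"
    and d: "\<And>x. x > 0 \<Longrightarrow> (u has_real_derivative u' x) (at x)"
    and ode: "\<And>x. x > 0 \<Longrightarrow> x * u' x + (s - \<alpha> * x) * u x = g x"
    and bd: "\<And>x. x > 0 \<Longrightarrow> \<bar>u x\<bar> \<le> C"
    and g: "\<And>x. x > 0 \<Longrightarrow> \<bar>g x\<bar> \<le> G"
    and "x > 0"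
  shows "\<bar>(s - \<alpha> * x) * u x\<bar> \<le> G"
proof -
  have "(s - \<alpha> * x) * u x \<le> G"
    by (rule gamma_first_order_bound_upper[OF assms(1,2) d ode bd g \<open>x > 0\<close>])
  moreover have "(s - \<alpha> * x) * (- u x) \<le> G"
  proof (rule gamma_first_order_bound_upper[OF assms(1,2), where u = "\<lambda>x. - u x"
        and u' = "\<lambda>x. - u' x" and g = "\<lambda>x. - g x" and C = C])
    show "t * - u' t + (s - \<alpha> * t) * - u t = - g t" if "t > 0" for t
      using ode[OF that] by (simp add: algebra_simps)
  qed (use g bd \<open>x > 0\<close> in \<open>auto intro!: derivative_eq_intros d\<close>)
  ultimately show ?thesis by (simp add: abs_if)
qed

section \<open>Solution of the Stein equation\<close>

text \<open>The exponential is \<open>exp (\<alpha> * x) * exp (- \<alpha> * t)\<close> at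
  \<open>t = x * q v\<close>. The weight \<open>m\<close> is a parameter because differentiation in
  \<open>x\<close> multiplies it by \<open>q v\<close> or \<open>1 - q v\<close>, so that
  derivatives stay in the family.\<close>

definition kernel_average ::
    "(real \<Rightarrow> real) \<Rightarrow> real \<Rightarrow> (real \<Rightarrow> real) \<Rightarrow> (real \<Rightarrow> real) \<Rightarrow> real \<Rightarrow> real" where
  "kernel_average q \<alpha> m k x = integral {0..1} (\<lambda>v. m v * k (x * q v) * exp (\<alpha> * x * (1 - q v)))"

lemma continuous_on_snd_comp:
  assumes "continuous_on {0..1} (m :: real \<Rightarrow> real)"
  shows "continuous_on (UNIV \<times> {0..1}) (\<lambda>p :: real \<times> real. m (snd p))"
  by (rule continuous_on_compose2[OF assms]) (auto intro!: continuous_intros)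

lemma continuous_on_kernel_integrand:
  fixes k m q :: "real \<Rightarrow> real"
  assumes q: "continuous_on {0..1} q" and m: "continuous_on {0..1} m" and k: "continuous_on UNIV k"
  shows "continuous_on (UNIV \<times> {0..1})
           (\<lambda>(x, v). m v * k (x * q v) * exp (\<alpha> * x * (1 - q v)))"
  unfolding split_beta
  by (intro continuous_intros continuous_on_snd_comp[OF m] continuous_on_snd_comp[OF q]
      continuous_on_compose2[OF k]) auto

lemma continuous_on_kernel_integrand_slice:
  fixes k m q :: "real \<Rightarrow> real"
  assumes "continuous_on {0..1} q" "continuous_on {0..1} m" "continuous_on UNIV k"
  shows "continuous_on {0..1} (\<lambda>v. m v * k (x * q v) * exp (\<alpha> * x * (1 - q v)))"
  by (intro continuous_intros assms continuous_on_compose2[OF assms(3)]) auto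

lemma integrable_kernel_integrand:
  fixes k m q :: "real \<Rightarrow> real"
  assumes "continuous_on {0..1} q" "continuous_on {0..1} m" "continuous_on UNIV k"
  shows "(\<lambda>v. m v * k (x * q v) * exp (\<alpha> * x * (1 - q v))) integrable_on {0..1}"
  by (rule integrable_continuous_real[OF continuous_on_kernel_integrand_slice[OF assms]])

lemma continuous_on_kernel_average:
  assumes "continuous_on {0..1} q" "continuous_on {0..1} m" "continuous_on UNIV k"
  shows "continuous_on UNIV (kernel_average q \<alpha> m k)"
  using integral_continuous_on_param[of UNIV 0 1
      "\<lambda>x v. m v * k (x * q v) * exp (\<alpha> * x * (1 - q v))"]
    continuous_on_kernel_integrand[OF assms]
  unfolding kernel_average_def by simp

lemma kernel_average_deriv:
  fixes k k' m q :: "real \<Rightarrow> real"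
  assumes q: "continuous_on {0..1} q" and m: "continuous_on {0..1} m"
    and k: "\<And>y. (k has_real_derivative k' y) (at y)" and k': "continuous_on UNIV k'"
  shows "(kernel_average q \<alpha> m k has_real_derivative
            kernel_average q \<alpha> (\<lambda>v. m v * q v) k' x
              + \<alpha> * kernel_average q \<alpha> (\<lambda>v. m v * (1 - q v)) k x) (at x)"
proof -
  have ck: "continuous_on UNIV k"
    using k by (auto intro!: DERIV_continuous_on intro: has_field_derivative_at_within)
  have mq: "continuous_on {0..1} (\<lambda>v. m v * q v)" "continuous_on {0..1} (\<lambda>v. m v * (1 - q v))"
    by (intro continuous_intros m q)+
  let ?fx = "\<lambda>x v. (m v * q v) * k' (x * q v) * exp (\<alpha> * x * (1 - q v))
               + \<alpha> * ((m v * (1 - q v)) * k (x * q v) * exp (\<alpha> * x * (1 - q v)))"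
  have "((\<lambda>x. integral (cbox 0 1) (\<lambda>v. m v * k (x * q v) * exp (\<alpha> * x * (1 - q v))))
          has_field_derivative integral (cbox 0 1) (?fx x)) (at x within UNIV)"
  proof (rule leibniz_rule_field_derivative)
    show "((\<lambda>x. m v * k (x * q v) * exp (\<alpha> * x * (1 - q v))) has_field_derivative ?fx y v)
        (at y within UNIV)" for y v
      by (auto intro!: derivative_eq_intros DERIV_chain2[OF k] simp: algebra_simps)
    show "(\<lambda>v. m v * k (y * q v) * exp (\<alpha> * y * (1 - q v))) integrable_on cbox 0 1" for y
      using integrable_kernel_integrand[OF q m ck] by simp
    show "continuous_on (UNIV \<times> cbox 0 1) (\<lambda>(x, v). ?fx x v)"
      using continuous_on_add[OF continuous_on_kernel_integrand[OF q mq(1) k', of \<alpha>]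
          continuous_on_mult_left[OF continuous_on_kernel_integrand[OF q mq(2) ck, of \<alpha>], of \<alpha>]]
      by (simp add: split_beta)
  qed auto
  also have "integral (cbox 0 1) (?fx x) = kernel_average q \<alpha> (\<lambda>v. m v * q v) k' x
              + \<alpha> * kernel_average q \<alpha> (\<lambda>v. m v * (1 - q v)) k x"
    unfolding kernel_average_def cbox_interval
    by (rule integral_unique, rule has_integral_add, rule integrable_integral,
        rule integrable_kernel_integrand[OF q mq(1) k'], rule has_integral_mult_right,
        rule integrable_integral, rule integrable_kernel_integrand[OF q mq(2) ck])
  finally show ?thesis unfolding kernel_average_def by simp
qed

text \<open>The substitution \<open>t = x v\<^bsup>1/r\<^esup>\<close> turns the solution
  \<open>x\<^bsup>-r\<^esup> e\<^bsup>\<alpha>x\<^esup> \<integral>\<^sub>0\<^sup>x k(t) t\<^bsup>r-1\<^esup> e\<^bsup>-\<alpha>t\<^esup> dt\<close> of the Stein equation into an average that is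
  as smooth as \<open>k\<close>, also at \<open>x = 0\<close>.\<close>

lemma kernel_average_stein_equation:
  fixes k k' :: "real \<Rightarrow> real"
  assumes "r > 0"
    and k: "\<And>y. (k has_real_derivative k' y) (at y)" and k': "continuous_on UNIV k'"
  defines "q \<equiv> \<lambda>v. v powr (1 / r)"
  shows "x * (kernel_average q \<alpha> (\<lambda>v. 1 / r * q v) k' x
               + \<alpha> * kernel_average q \<alpha> (\<lambda>v. 1 / r * (1 - q v)) k x)
           + (r - \<alpha> * x) * kernel_average q \<alpha> (\<lambda>_. 1 / r) k x = k x"
proof -
  have ck: "continuous_on UNIV k"
    using k by (auto intro!: DERIV_continuous_on intro: has_field_derivative_at_within)
  have q: "continuous_on {0..1} q"
    unfolding q_def using \<open>r > 0\<close> by (auto intro!: continuous_intros continuous_on_powr')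
  let ?e = "\<lambda>v. exp (\<alpha> * x * (1 - q v))"
  let ?F = "\<lambda>v. v * k (x * q v) * ?e v"
  let ?I1 = "\<lambda>v. 1 / r * q v * k' (x * q v) * ?e v"
  let ?I2 = "\<lambda>v. 1 / r * (1 - q v) * k (x * q v) * ?e v"
  let ?I3 = "\<lambda>v. 1 / r * k (x * q v) * ?e v"
  let ?F' = "\<lambda>v. x * (?I1 v + \<alpha> * ?I2 v) + (r - \<alpha> * x) * ?I3 v"
  \<comment> \<open>The left-hand side of the equation is the integral of the
    \<open>v\<close>-derivative of \<open>?F\<close>, and \<open>?F\<close> is \<open>0\<close> at
    \<open>v = 0\<close> and \<open>k x\<close> at \<open>v = 1\<close>. For \<open>r > 1\<close>
    the power \<open>q\<close> has infinite slope at \<open>0\<close>, so differentiability is used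
    in the interior only.\<close>
  have "(?F' has_integral (?F 1 - ?F 0)) {0..1}"
  proof (rule fundamental_theorem_of_calculus_interior)
    show "continuous_on {0..1} ?F"
      using continuous_on_kernel_integrand_slice[OF q _ ck, of "\<lambda>v. v" x \<alpha>]
      by (simp add: continuous_on_id)
    show "(?F has_vector_derivative ?F' v) (at v)" if "v \<in> {0<..<1}" for v
    proof -
      define q' where "q' = q v / (r * v)"
      have "(q has_real_derivative q') (at v)"
        unfolding q_def
      proof (rule DERIV_cong[OF has_real_derivative_powr])
        have "v powr (1 / r - 1) = v powr (1 / r) / v"
          by (subst powr_diff) (use that in simp)
        then show "1 / r * v powr (1 / r - 1) = q'"
          by (simp only: q'_def q_def times_divide_times_eq mult_1)
      qed (use that in simp)
      then have "(?F has_real_derivative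
            k (x * q v) * ?e v + v * (k' (x * q v) * (x * q')) * ?e v
              + v * k (x * q v) * (?e v * (- (\<alpha> * x * q')))) (at v)"
        by (auto intro!: derivative_eq_intros DERIV_chain2[OF k] simp: algebra_simps)
      also have "k (x * q v) * ?e v + v * (k' (x * q v) * (x * q')) * ?e v
              + v * k (x * q v) * (?e v * (- (\<alpha> * x * q'))) = ?F' v"
        using that \<open>r > 0\<close> by (simp add: q'_def field_simps)
      finally show ?thesis by (simp add: has_real_derivative_iff_has_vector_derivative)
    qed
  qed auto
  moreover have "(?F' has_integral x * (integral {0..1} ?I1 + \<alpha> * integral {0..1} ?I2)
      + (r - \<alpha> * x) * integral {0..1} ?I3) {0..1}"
    by (intro has_integral_add has_integral_mult_right integrable_integral
        integrable_kernel_integrand q ck k' continuous_intros)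
  ultimately have "x * (integral {0..1} ?I1 + \<alpha> * integral {0..1} ?I2)
      + (r - \<alpha> * x) * integral {0..1} ?I3 = ?F 1 - ?F 0"
    by (rule has_integral_unique[rotated])
  also have "?F 1 - ?F 0 = k x" by (simp add: q_def)
  finally show ?thesis unfolding kernel_average_def .
qed

text \<open>The derivatives are again averages of \<open>k\<close>, \<open>k'\<close> and
  \<open>k''\<close>; nothing is divided by \<open>x\<close>, so \<open>f\<close> is twice
  continuously differentiable across \<open>0\<close>.\<close>

lemma kernel_average_C2:
  fixes k k' k'' :: "real \<Rightarrow> real"
  assumes "r > 0"
    and k: "\<And>y. (k has_real_derivative k' y) (at y)"
    and k': "\<And>y. (k' has_real_derivative k'' y) (at y)"
    and k'': "continuous_on UNIV k''"
  obtains f f' f'' where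
    "\<And>x. (f has_real_derivative f' x) (at x)" "\<And>x. (f' has_real_derivative f'' x) (at x)"
    "continuous_on UNIV f''" "\<And>x. x * f' x + (r - \<alpha> * x) * f x = k x"
proof -
  define q where "q = (\<lambda>v::real. v powr (1 / r))"
  have q: "continuous_on {0..1} q"
    unfolding q_def using \<open>r > 0\<close> by (auto intro!: continuous_intros continuous_on_powr')
  have ck: "continuous_on UNIV k" "continuous_on UNIV k'"
    using k k' by (auto intro!: DERIV_continuous_on intro: has_field_derivative_at_within)
  let ?J = "kernel_average q \<alpha>"
  have m: "continuous_on {0..1} (\<lambda>v. 1 / r * q v)" "continuous_on {0..1} (\<lambda>v. 1 / r * (1 - q v))"
    "continuous_on {0..1} (\<lambda>v::real. 1 / r)"
    by (intro continuous_intros q)+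
  show ?thesis
  proof (rule that)
    show "(?J (\<lambda>_. 1 / r) k has_real_derivative
        ?J (\<lambda>v. 1 / r * q v) k' x + \<alpha> * ?J (\<lambda>v. 1 / r * (1 - q v)) k x) (at x)" for x
      by (rule kernel_average_deriv[OF q m(3) k ck(2)])
    show "((\<lambda>x. ?J (\<lambda>v. 1 / r * q v) k' x + \<alpha> * ?J (\<lambda>v. 1 / r * (1 - q v)) k x) has_real_derivative
        (?J (\<lambda>v. 1 / r * q v * q v) k'' x + \<alpha> * ?J (\<lambda>v. 1 / r * q v * (1 - q v)) k' x)
        + \<alpha> * (?J (\<lambda>v. 1 / r * (1 - q v) * q v) k' x
                + \<alpha> * ?J (\<lambda>v. 1 / r * (1 - q v) * (1 - q v)) k x)) (at x)" for x
      by (intro DERIV_add DERIV_cmult kernel_average_deriv q m k k' ck k'')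
    show "continuous_on UNIV (\<lambda>x.
        (?J (\<lambda>v. 1 / r * q v * q v) k'' x + \<alpha> * ?J (\<lambda>v. 1 / r * q v * (1 - q v)) k' x)
        + \<alpha> * (?J (\<lambda>v. 1 / r * (1 - q v) * q v) k' x
                + \<alpha> * ?J (\<lambda>v. 1 / r * (1 - q v) * (1 - q v)) k x))"
      by (intro continuous_intros continuous_on_kernel_average q ck k'')
    show "x * (?J (\<lambda>v. 1 / r * q v) k' x + \<alpha> * ?J (\<lambda>v. 1 / r * (1 - q v)) k x)
        + (r - \<alpha> * x) * ?J (\<lambda>_. 1 / r) k x = k x" for x
      unfolding q_def by (rule kernel_average_stein_equation[OF \<open>r > 0\<close> k ck(2)])
  qed
qed

section \<open>A priori bounds on the solution\<close>

definition gamma_weight :: "real \<Rightarrow> real \<Rightarrow> real \<Rightarrow> real" where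
  "gamma_weight r \<alpha> t = indicator {0<..} t * (t powr (r - 1) * exp (- \<alpha> * t))"

text \<open>By the integrating factor, the weighted solution at \<open>y\<close> is the integral of
  \<open>gamma_weight r \<alpha> t * k t\<close> up to \<open>y\<close>, so its limit is the full
  integral. The centering of \<open>k\<close> thus excludes the component that grows like
  \<open>x powr (- r) * exp (\<alpha> * x)\<close>.\<close>

lemma weighted_solution_tendsto_0:
  fixes f f' k :: "real \<Rightarrow> real"
  assumes "r > 0"
    and d: "\<And>x. (f has_real_derivative f' x) (at x)"
    and ode: "\<And>x. x * f' x + (r - \<alpha> * x) * f x = k x"
    and int: "integrable lborel (\<lambda>t. gamma_weight r \<alpha> t * k t)"
    and mean: "(LINT t|lborel. gamma_weight r \<alpha> t * k t) = 0"
  shows "((\<lambda>x. x powr r * exp (- \<alpha> * x) * f x) \<longlongrightarrow> 0) at_top"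
proof -
  let ?\<phi> = "\<lambda>t. gamma_weight r \<alpha> t * k t"
  let ?P = "\<lambda>x. x powr r * exp (- \<alpha> * x) * f x"
  have cf: "continuous_on A f" for A
    using d by (auto intro!: DERIV_continuous_on intro: has_field_derivative_at_within)
  have eq: "(LINT t|lborel. indicator {..y} t *\<^sub>R ?\<phi> t) = ?P y" if "y > 0" for y
  proof -
    have "(?\<phi> has_integral (?P y - ?P 0)) {0..y}"
    proof (rule fundamental_theorem_of_calculus_interior)
      show "continuous_on {0..y} ?P"
        using \<open>r > 0\<close> by (intro continuous_intros continuous_on_powr' cf) auto
      show "(?P has_vector_derivative ?\<phi> x) (at x)" if "x \<in> {0<..<y}" for x
        using gamma_weight_deriv_mult[OF _ d[of x], of r \<alpha>] that ode[of x]
        by (simp add: has_real_derivative_iff_has_vector_derivative gamma_weight_def)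
    qed (use that in auto)
    then have 1: "(?\<phi> has_integral ?P y) {0..y}" using \<open>r > 0\<close> by simp
    have ind: "indicator {..y} t *\<^sub>R ?\<phi> t = indicator {0..y} t *\<^sub>R ?\<phi> t" for t
      by (auto simp: gamma_weight_def indicator_def)
    have "set_integrable lborel {0..y} ?\<phi>"
      unfolding set_integrable_def using int by (intro integrable_mult_indicator) auto
    from set_borel_integral_eq_integral(2)[OF this] 1
    show ?thesis unfolding ind set_lebesgue_integral_def by (simp add: integral_unique)
  qed
  have "((\<lambda>y. LINT t|lborel. indicator {..y} t *\<^sub>R ?\<phi> t) \<longlongrightarrow> 0) at_top"
    using tendsto_integral_at_top[OF _ int] mean by simp
  then show ?thesis
    by (rule Lim_transform_eventually)
       (use eq in \<open>auto simp: eventually_at_top_dense intro!: exI[of _ 0]\<close>)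
qed

text \<open>Far out a constant dominates the solution: once \<open>2 * r \<le> \<alpha> * t\<close>,
  the coefficient \<open>r - \<alpha> * t\<close> is at most \<open>- \<alpha> * t / 2\<close>, so
  applied to \<open>2 * c / \<alpha>\<close> it gives at most \<open>- c * t \<le> k t\<close>. The
  weighted difference of that constant and \<open>f\<close> is then nonincreasing with limit
  \<open>0\<close>, hence nonnegative.\<close>

lemma solution_tail_bound_upper:
  fixes f f' k :: "real \<Rightarrow> real"
  assumes "r > 0" "\<alpha> > 0" "x\<^sub>0 > 0" "2 * r \<le> \<alpha> * x\<^sub>0"
    and d: "\<And>x. (f has_real_derivative f' x) (at x)"
    and ode: "\<And>x. x * f' x + (r - \<alpha> * x) * f x = k x"
    and k: "\<And>x. x \<ge> x\<^sub>0 \<Longrightarrow> \<bar>k x\<bar> \<le> c * x"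
    and lim: "((\<lambda>x. x powr r * exp (- \<alpha> * x) * f x) \<longlongrightarrow> 0) at_top"
    and x: "x \<ge> x\<^sub>0"
  shows "f x \<le> 2 * c / \<alpha>"
proof -
  let ?E = "\<lambda>x. x powr r * exp (- \<alpha> * x)"
  let ?Q = "\<lambda>x. ?E x * (2 * c / \<alpha> - f x)"
  let ?q = "\<lambda>x. x powr (r - 1) * exp (- \<alpha> * x) * ((r - \<alpha> * x) * (2 * c / \<alpha>) - k x)"
  have "c * x\<^sub>0 \<ge> 0" using k[of x\<^sub>0] by linarith
  then have c: "c \<ge> 0" using \<open>x\<^sub>0 > 0\<close> by (simp add: zero_le_mult_iff)
  have dQ: "(?Q has_real_derivative ?q t) (at t)" if "t > 0" for t
    using that
    by (intro DERIV_cong[OF gamma_weight_deriv_mult[where u' = "- f' t"]])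
       (auto intro!: derivative_eq_intros d simp: algebra_simps simp flip: ode[of t])
  have q: "?q t \<le> 0" if "t \<ge> x\<^sub>0" for t
  proof -
    have "2 * r \<le> \<alpha> * t" using assms(2,4) that mult_left_mono[of x\<^sub>0 t \<alpha>] by linarith
    then have "(r - \<alpha> * t) * (2 * c / \<alpha>) \<le> (- (\<alpha> * t / 2)) * (2 * c / \<alpha>)"
      using c \<open>\<alpha> > 0\<close> by (intro mult_right_mono) auto
    also have "\<dots> = - (c * t)" using \<open>\<alpha> > 0\<close> by (simp add: field_simps)
    finally have "(r - \<alpha> * t) * (2 * c / \<alpha>) - k t \<le> 0" using k[OF that] by linarith
    then show ?thesis by (intro mult_nonneg_nonpos) auto
  qed
  have mono: "?Q t \<le> ?Q x" if "t \<ge> x" for t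
  proof (rule DERIV_nonpos_imp_nonincreasing[where f = ?Q])
    show "\<exists>y. (?Q has_real_derivative y) (at z) \<and> y \<le> 0" if "x \<le> z" "z \<le> t" for z
      using dQ[of z] q[of z] that x \<open>x\<^sub>0 > 0\<close> by (intro exI[of _ "?q z"] conjI) auto
  qed (use that in simp)
  have "(?E \<longlongrightarrow> 0) at_top" using \<open>\<alpha> > 0\<close> by real_asymp
  from tendsto_diff[OF tendsto_mult_left_zero[OF this, of "2 * c / \<alpha>"] lim]
  have "(?Q \<longlongrightarrow> 0) at_top" by (simp add: algebra_simps)
  then have "?Q x \<ge> 0"
    by (rule tendsto_upperbound)
       (use mono in \<open>auto simp: eventually_at_top_linorder simp del: times_divide_eq_right intro!: exI[of _ x]\<close>)
  moreover have "?E x > 0" using x \<open>x\<^sub>0 > 0\<close> by simp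
  ultimately show ?thesis by (simp add: zero_le_mult_iff)
qed

lemma solution_tail_bound:
  fixes f f' k :: "real \<Rightarrow> real"
  assumes "r > 0" "\<alpha> > 0" "x\<^sub>0 > 0" "2 * r \<le> \<alpha> * x\<^sub>0"
    and d: "\<And>x. (f has_real_derivative f' x) (at x)"
    and ode: "\<And>x. x * f' x + (r - \<alpha> * x) * f x = k x"
    and k: "\<And>x. x \<ge> x\<^sub>0 \<Longrightarrow> \<bar>k x\<bar> \<le> c * x"
    and lim: "((\<lambda>x. x powr r * exp (- \<alpha> * x) * f x) \<longlongrightarrow> 0) at_top"
    and x: "x \<ge> x\<^sub>0"
  shows "\<bar>f x\<bar> \<le> 2 * c / \<alpha>"
proof -
  have "f x \<le> 2 * c / \<alpha>"
    by (rule solution_tail_bound_upper[OF assms(1-4) d ode k lim x])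
  moreover have "- f x \<le> 2 * c / \<alpha>"
  proof (rule solution_tail_bound_upper[OF assms(1-4), where f = "\<lambda>x. - f x" and f' = "\<lambda>x. - f' x"
        and k = "\<lambda>x. - k x"])
    show "t * - f' t + (r - \<alpha> * t) * - f t = - k t" for t
      using ode[of t] by (simp add: algebra_simps)
    show "((\<lambda>x. x powr r * exp (- \<alpha> * x) * - f x) \<longlongrightarrow> 0) at_top"
      using tendsto_minus[OF lim] by simp
  qed (use k x in \<open>auto intro!: derivative_eq_intros d\<close>)
  ultimately show ?thesis by (simp add: abs_if)
qed

lemma bounded_on_nonneg:
  fixes f :: "real \<Rightarrow> real"
  assumes "continuous_on UNIV f" and "\<And>x. x \<ge> x\<^sub>0 \<Longrightarrow> \<bar>f x\<bar> \<le> c"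
  obtains C where "\<And>x. x \<ge> 0 \<Longrightarrow> \<bar>f x\<bar> \<le> C"
proof -
  have "bounded (f ` {0..x\<^sub>0})"
    by (intro compact_imp_bounded compact_continuous_image continuous_on_subset[OF assms(1)]) auto
  then obtain b where b: "\<And>x. x \<in> {0..x\<^sub>0} \<Longrightarrow> \<bar>f x\<bar> \<le> b"
    unfolding bounded_iff by force
  show ?thesis
  proof (rule that[of "max b c"])
    show "\<bar>f x\<bar> \<le> max b c" if "x \<ge> 0" for x
      using b[of x] assms(2)[of x] that by (cases "x \<le> x\<^sub>0") auto
  qed
qed

text \<open>The derivative is bounded only strictly to the right of \<open>a\<close>, since the
  estimates of \<open>f''\<close> hold for \<open>x > 0\<close> only; the mean value point lies in
  the open interval, so \<open>a\<close> itself is still covered.\<close>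

lemma deriv_le_imp_diff_le:
  fixes f :: "real \<Rightarrow> real"
  assumes "\<And>x. (f has_real_derivative f' x) (at x)" "\<And>x. x > a \<Longrightarrow> \<bar>f' x\<bar> \<le> B"
    and "x \<ge> a" "y \<ge> a"
  shows "\<bar>f x - f y\<bar> \<le> B * \<bar>x - y\<bar>"
proof -
  have *: "\<bar>f y - f x\<bar> \<le> B * \<bar>y - x\<bar>" if "a \<le> x" "x < y" for x y
  proof -
    obtain z where z: "x < z" "z < y" "f y - f x = (y - x) * f' z"
      using MVT2[OF \<open>x < y\<close>, of f f'] assms(1) by auto
    have "\<bar>f' z\<bar> \<le> B" using z that by (intro assms(2)) auto
    then show ?thesis using z that by (simp add: abs_mult mult.commute mult_left_mono)
  qed
  show ?thesis using *[of x y] *[of y x] assms(3,4) by (cases x y rule: linorder_cases) (auto simp: abs_minus_commute)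
qed

theorem gamma_stein_solution:
  fixes k k' k'' :: "real \<Rightarrow> real"
  assumes "r > 0" "\<alpha> > 0"
    and k: "\<And>y. (k has_real_derivative k' y) (at y)"
    and k': "\<And>y. (k' has_real_derivative k'' y) (at y)"
    and k'': "continuous_on UNIV k''"
    and H1: "\<And>y. \<bar>k' y\<bar> \<le> H\<^sub>1" and H2: "\<And>y. \<bar>k'' y\<bar> \<le> H\<^sub>2"
    and int: "integrable lborel (\<lambda>t. gamma_weight r \<alpha> t * k t)"
    and mean: "(LINT t|lborel. gamma_weight r \<alpha> t * k t) = 0"
  obtains f f' C where
    "\<And>x. (f has_real_derivative f' x) (at x)" "\<And>x. x * f' x + (r - \<alpha> * x) * f x = k x"
    "\<And>x. x \<ge> 0 \<Longrightarrow> \<bar>f x\<bar> \<le> C"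
    "\<And>x y. x \<ge> 0 \<Longrightarrow> y \<ge> 0 \<Longrightarrow> \<bar>f' x - f' y\<bar> \<le> (2 * H\<^sub>2 + 4 * \<alpha> * H\<^sub>1) / (r + 2) * \<bar>x - y\<bar>"
proof -
  obtain f f' f'' where f: "\<And>x. (f has_real_derivative f' x) (at x)"
    and f': "\<And>x. (f' has_real_derivative f'' x) (at x)"
    and f'': "continuous_on UNIV f''" and ode: "\<And>x. x * f' x + (r - \<alpha> * x) * f x = k x"
    using kernel_average_C2[OF \<open>r > 0\<close> k k' k''] by blast
  have H10: "H\<^sub>1 \<ge> 0" using H1[of 0] by linarith
  have cf: "continuous_on UNIV f" "continuous_on UNIV f'"
    using f f' by (auto intro!: DERIV_continuous_on intro: has_field_derivative_at_within)
  have ode1: "x * f'' x + (r + 1 - \<alpha> * x) * f' x - \<alpha> * f x = k' x" for x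
  proof -
    have "((\<lambda>x. x * f' x + (r - \<alpha> * x) * f x) has_real_derivative
        x * f'' x + (r + 1 - \<alpha> * x) * f' x - \<alpha> * f x) (at x)"
      by (auto intro!: derivative_eq_intros f f' simp: algebra_simps)
    with k[of x] show ?thesis unfolding ode by (rule DERIV_unique[rotated])
  qed
  \<comment> \<open>\<open>k''\<close> is merely continuous, so the averages cannot be
    differentiated a third time. For \<open>x > 0\<close>, however, the once differentiated equation
    expresses \<open>f''\<close> through \<open>k'\<close>, \<open>f'\<close> and \<open>f\<close>,
    which are all differentiable.\<close>
  define f''' where "f''' = (\<lambda>x. (k'' x - (r + 2 - \<alpha> * x) * f'' x + 2 * \<alpha> * f' x) / x)"
  have f''_eq: "f'' x = (k' x - (r + 1 - \<alpha> * x) * f' x + \<alpha> * f x) / x" if "x > 0" for x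
    using ode1[of x] that by (simp add: field_simps)
  have f''': "(f'' has_real_derivative f''' x) (at x)" if "x > 0" for x
  proof -
    have "((\<lambda>x. (k' x - (r + 1 - \<alpha> * x) * f' x + \<alpha> * f x) / x) has_real_derivative
        ((k'' x - ((r + 1 - \<alpha> * x) * f'' x - \<alpha> * f' x) + \<alpha> * f' x) * x
          - (k' x - (r + 1 - \<alpha> * x) * f' x + \<alpha> * f x)) / (x * x)) (at x)"
      using that by (auto intro!: derivative_eq_intros f f' k' simp: algebra_simps)
    also have "((k'' x - ((r + 1 - \<alpha> * x) * f'' x - \<alpha> * f' x) + \<alpha> * f' x) * x
          - (k' x - (r + 1 - \<alpha> * x) * f' x + \<alpha> * f x)) / (x * x) = f''' x"
      using that ode1[of x, symmetric] by (simp add: f'''_def field_simps)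
    finally show ?thesis
      by (rule has_field_derivative_transform_within_open[where S = "{0<..}"])
         (use that f''_eq in auto)
  qed
  have ode2: "x * f''' x + (r + 2 - \<alpha> * x) * f'' x - 2 * \<alpha> * f' x = k'' x" if "x > 0" for x
    using that by (simp add: f'''_def)

  \<comment> \<open>The bound \<open>2 * r / \<alpha>\<close> is what the tail estimate requires;
    the bound \<open>1\<close> allows constants to be absorbed into multiples of
    \<open>x\<close>.\<close>
  define x\<^sub>0 where "x\<^sub>0 = max 1 (2 * r / \<alpha>)"
  have x0: "x\<^sub>0 \<ge> 1" "2 * r \<le> \<alpha> * x\<^sub>0"
    using \<open>\<alpha> > 0\<close> by (auto simp: x\<^sub>0_def max_def field_simps)
  define c where "c = \<bar>k 0\<bar> + H\<^sub>1"
  have kb: "\<bar>k x\<bar> \<le> c * x" if "x \<ge> x\<^sub>0" for x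
  proof -
    have "\<bar>k x - k 0\<bar> \<le> H\<^sub>1 * \<bar>x - 0\<bar>"
      by (rule deriv_le_imp_diff_le[OF k, of 0]) (use H1 that x0 in auto)
    moreover have "\<bar>k 0\<bar> * 1 \<le> \<bar>k 0\<bar> * x" using that x0 by (intro mult_left_mono) auto
    ultimately show ?thesis using that x0 by (simp add: c_def algebra_simps)
  qed
  have lim: "((\<lambda>x. x powr r * exp (- \<alpha> * x) * f x) \<longlongrightarrow> 0) at_top"
    by (rule weighted_solution_tendsto_0[OF \<open>r > 0\<close> f ode int mean])
  have fb: "\<bar>f x\<bar> \<le> 2 * c / \<alpha>" if "x \<ge> x\<^sub>0" for x
    by (rule solution_tail_bound[OF assms(1,2) _ x0(2) f ode kb lim that]) (use x0 in auto)
  \<comment> \<open>Both \<open>f'\<close> and \<open>f''\<close> are, by their equations,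
    numerators of at most linear growth divided by \<open>x\<close>, hence bounded for large
    \<open>x\<close>.\<close>
  have divb: "\<bar>(p - (s - \<alpha> * x) * y + z) / x\<bar> \<le> (\<bar>s\<bar> + \<alpha>) * b + p' + z'"
    if "x \<ge> x\<^sub>0" "\<bar>p\<bar> \<le> p' * x" "\<bar>y\<bar> \<le> b" "\<bar>z\<bar> \<le> z'" for p p' s y b z z' x :: real
  proof -
    have x: "x \<ge> 1" using that x0 by linarith
    have "\<bar>(s - \<alpha> * x) * y\<bar> \<le> (\<bar>s\<bar> + \<alpha> * x) * b"
      unfolding abs_mult using that \<open>\<alpha> > 0\<close> x abs_triangle_ineq4[of s "\<alpha> * x"]
      by (intro mult_mono) (auto simp: abs_mult)
    also have "\<dots> \<le> (\<bar>s\<bar> * x + \<alpha> * x) * b"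
      using that(3) x mult_left_mono[of 1 x "\<bar>s\<bar>"] by (intro mult_right_mono) auto
    moreover have "z' * 1 \<le> z' * x" using that(4) x by (intro mult_left_mono) auto
    ultimately have "\<bar>p - (s - \<alpha> * x) * y + z\<bar> \<le> ((\<bar>s\<bar> + \<alpha>) * b + p' + z') * x"
      using that by (simp add: algebra_simps abs_le_iff)
    then show ?thesis using x by (simp add: field_simps)
  qed
  have f'b: "\<bar>f' x\<bar> \<le> (\<bar>r\<bar> + \<alpha>) * (2 * c / \<alpha>) + c + 0" if "x \<ge> x\<^sub>0" for x
  proof -
    have "f' x = (k x - (r - \<alpha> * x) * f x + 0) / x"
      using ode[of x] that x0 by (simp add: field_simps)
    then show ?thesis using divb[OF that kb[OF that] fb[OF that], of 0 0 r] by simp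
  qed
  have f''b: "\<bar>f'' x\<bar> \<le> (\<bar>r + 1\<bar> + \<alpha>) * ((\<bar>r\<bar> + \<alpha>) * (2 * c / \<alpha>) + c + 0) + H\<^sub>1 + \<alpha> * (2 * c / \<alpha>)"
    if "x \<ge> x\<^sub>0" for x
  proof -
    have "\<bar>k' x\<bar> \<le> H\<^sub>1 * x" 
      using H1[of x] mult_left_mono[of 1 x H\<^sub>1] H10 that x0 by auto
    moreover have "\<bar>\<alpha> * f x\<bar> \<le> \<alpha> * (2 * c / \<alpha>)"
      unfolding abs_mult using fb[OF that] \<open>\<alpha> > 0\<close> by (intro mult_mono) auto
    ultimately show ?thesis
      using divb[OF that _ f'b[OF that], of "k' x" H\<^sub>1 "\<alpha> * f x" _ "r + 1"] f''_eq[of x] that x0 by simp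
  qed
  \<comment> \<open>The sizes of \<open>C0\<close>, \<open>C1\<close> and \<open>C2\<close> do not
    enter the Lipschitz constant; these bounds only make the maximum principle and the first order
    estimate applicable.\<close>
  obtain C0 where C0: "\<And>x. x \<ge> 0 \<Longrightarrow> \<bar>f x\<bar> \<le> C0" using bounded_on_nonneg[OF cf(1) fb] by blast
  obtain C1 where C1: "\<And>x. x \<ge> 0 \<Longrightarrow> \<bar>f' x\<bar> \<le> C1" using bounded_on_nonneg[OF cf(2) f'b] by blast
  obtain C2 where C2: "\<And>x. x \<ge> 0 \<Longrightarrow> \<bar>f'' x\<bar> \<le> C2" using bounded_on_nonneg[OF f'' f''b] by blast

  have B0: "\<alpha> * \<bar>f x\<bar> \<le> H\<^sub>1" if "x > 0" for x
    by (rule gamma_max_principle[where s = "r + 1" and u = f and u' = f' and u'' = f'' and g = k'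
          and C = C0 and \<alpha> = \<alpha>]) (use assms(1,2) that H1 f f' ode1 C0 in auto)
  have B1: "2 * \<alpha> * \<bar>f' x\<bar> \<le> H\<^sub>2" if "x > 0" for x
    by (rule gamma_max_principle[where s = "r + 2" and u = f' and u' = f'' and u'' = f''' and g = k''
          and C = C1 and \<alpha> = \<alpha>]) (use assms(1,2) that H2 f' f''' ode2 C1 in auto)
  \<comment> \<open>With \<open>\<alpha> * f\<close> moved to the right, the equation is of first
    order in \<open>f'\<close> with right-hand side at most \<open>2 * H\<^sub>1\<close>. The drift
    term obeys the same bound, and \<open>x * f'' x\<close> is the difference of the two.
    \<open>B3\<close> treats \<open>f''\<close> in the same way but keeps the drift term
    itself.\<close>
  have B2: "\<bar>x * f'' x\<bar> \<le> 4 * H\<^sub>1" if "x > 0" for x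
  proof -
    let ?g = "\<lambda>x. k' x + \<alpha> * f x"
    have g: "\<bar>?g y\<bar> \<le> 2 * H\<^sub>1" if "y > 0" for y
    proof -
      have "\<bar>\<alpha> * f y\<bar> \<le> H\<^sub>1" using B0[OF that] \<open>\<alpha> > 0\<close> by (simp add: abs_mult)
      then show ?thesis using H1[of y] by linarith
    qed
    have e: "y * f'' y + (r + 1 - \<alpha> * y) * f' y = ?g y" for y
      using ode1[of y] by simp
    have "\<bar>(r + 1 - \<alpha> * x) * f' x\<bar> \<le> 2 * H\<^sub>1"
      by (rule gamma_first_order_bound[OF _ \<open>\<alpha> > 0\<close> f' e C1 g that]) (use \<open>r > 0\<close> in auto)
    then show ?thesis using g[OF that] e[of x] by linarith
  qed
  have B3: "\<bar>(r + 2 - \<alpha> * x) * f'' x\<bar> \<le> 2 * H\<^sub>2" if "x > 0" for x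
  proof -
    let ?g = "\<lambda>x. k'' x + 2 * \<alpha> * f' x"
    have g: "\<bar>?g y\<bar> \<le> 2 * H\<^sub>2" if "y > 0" for y
    proof -
      have "\<bar>2 * \<alpha> * f' y\<bar> \<le> H\<^sub>2" using B1[OF that] \<open>\<alpha> > 0\<close> by (simp add: abs_mult)
      then show ?thesis using H2[of y] by linarith
    qed
    have e: "y * f''' y + (r + 2 - \<alpha> * y) * f'' y = ?g y" if "y > 0" for y
      using ode2[OF that] by simp
    show ?thesis
      by (rule gamma_first_order_bound[OF _ \<open>\<alpha> > 0\<close> f''' e C2 g that]) (use \<open>r > 0\<close> in auto)
  qed
  have B: "\<bar>f'' x\<bar> \<le> (2 * H\<^sub>2 + 4 * \<alpha> * H\<^sub>1) / (r + 2)" if "x > 0" for x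
  proof -
    have "(r + 2) * f'' x = \<alpha> * (x * f'' x) + (r + 2 - \<alpha> * x) * f'' x" by (simp add: algebra_simps)
    moreover have "\<bar>\<alpha> * (x * f'' x)\<bar> \<le> \<alpha> * (4 * H\<^sub>1)"
      using mult_left_mono[OF B2[OF that], of \<alpha>] \<open>\<alpha> > 0\<close> by (simp add: abs_mult)
    ultimately have "\<bar>(r + 2) * f'' x\<bar> \<le> 2 * H\<^sub>2 + 4 * \<alpha> * H\<^sub>1" using B3[OF that] by linarith
    then show ?thesis using \<open>r > 0\<close> by (simp add: abs_mult field_simps)
  qed
  show ?thesis
    by (rule that[of f f' C0]) (use f ode C0 deriv_le_imp_diff_le[OF f' B] in auto)
qed

section \<open>Smoothing\<close>

lemma antiderivative_real:
  fixes h :: "real \<Rightarrow> real"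
  assumes "continuous_on UNIV h"
  obtains A where "\<And>x. (A has_real_derivative h x) (at x)"
proof -
  have "\<exists>A. \<forall>x. -\<infinity> < ereal x \<longrightarrow> ereal x < \<infinity> \<longrightarrow> (A has_vector_derivative h x) (at x)"
    by (rule einterval_antiderivative)
       (use assms in \<open>auto simp: continuous_on_eq_continuous_at\<close>)
  then show ?thesis
    using that by (auto simp: has_real_derivative_iff_has_vector_derivative)
qed

text \<open>\<open>g x\<close> averages \<open>h\<close> twice over windows of length \<open>\<epsilon>\<close> to the right of \<open>x\<close>: it is the second
  difference quotient of a second antiderivative of \<open>h\<close>.\<close>

lemma double_average:
  fixes h :: "real \<Rightarrow> real"
  assumes lip: "\<And>x y. \<bar>h x - h y\<bar> \<le> L * \<bar>x - y\<bar>" and "\<epsilon> > 0"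
  obtains g g' where
    "\<And>x. (g has_real_derivative g' x) (at x)"
    "\<And>x. (g' has_real_derivative ((h (x + 2 * \<epsilon>) - h (x + \<epsilon>)) - (h (x + \<epsilon>) - h x)) / \<epsilon>\<^sup>2) (at x)"
    "\<And>x. \<bar>g' x\<bar> \<le> L"
    "\<And>x. \<exists>y. x \<le> y \<and> y \<le> x + 2 * \<epsilon> \<and> g x = h y"
proof -
  have "L \<ge> 0" using lip[of 1 0] by simp
  then have "L-lipschitz_on UNIV h" using lip by (auto simp: lipschitz_on_def dist_real_def)
  then have ch: "continuous_on UNIV h" by (rule lipschitz_on_continuous_on)
  obtain A where A: "\<And>x. (A has_real_derivative h x) (at x)" using antiderivative_real[OF ch] by blast
  then have "continuous_on UNIV A"
    by (auto intro!: DERIV_continuous_on intro: has_field_derivative_at_within)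
  then obtain B where B: "\<And>x. (B has_real_derivative A x) (at x)" using antiderivative_real by blast
  define A1 where "A1 = (\<lambda>x. A (x + \<epsilon>) - A x)"
  define B1 where "B1 = (\<lambda>x. B (x + \<epsilon>) - B x)"
  have shift: "((\<lambda>x. F (x + \<epsilon>)) has_real_derivative F' (x + \<epsilon>)) (at x)"
    if "\<And>x. (F has_real_derivative F' x) (at x)" for F F' :: "real \<Rightarrow> real" and x
    using that[of "x + \<epsilon>"] by (simp add: DERIV_shift)
  have A1: "(A1 has_real_derivative h (x + \<epsilon>) - h x) (at x)" for x
    unfolding A1_def by (intro DERIV_diff shift A)
  have B1: "(B1 has_real_derivative A1 x) (at x)" for x
    unfolding A1_def B1_def by (intro DERIV_diff shift B)
  have mvt: "\<exists>z. x < z \<and> z < x + \<epsilon> \<and> F (x + \<epsilon>) - F x = \<epsilon> * F' z"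
    if "\<And>x. (F has_real_derivative F' x) (at x)" for F F' :: "real \<Rightarrow> real" and x
    using MVT2[of x "x + \<epsilon>" F F'] that \<open>\<epsilon> > 0\<close> by auto
  show ?thesis
  proof (rule that)
    show "((\<lambda>x. (B1 (x + \<epsilon>) - B1 x) / \<epsilon>\<^sup>2) has_real_derivative (A1 (x + \<epsilon>) - A1 x) / \<epsilon>\<^sup>2) (at x)" for x
      by (intro DERIV_cdivide DERIV_diff shift B1)
    show "((\<lambda>x. (A1 (x + \<epsilon>) - A1 x) / \<epsilon>\<^sup>2) has_real_derivative
        ((h (x + 2 * \<epsilon>) - h (x + \<epsilon>)) - (h (x + \<epsilon>) - h x)) / \<epsilon>\<^sup>2) (at x)" for x
    proof -
      have "x + 2 * \<epsilon> = x + \<epsilon> + \<epsilon>" by simp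
      then show ?thesis by (simp only:) (intro DERIV_cdivide DERIV_diff shift[OF A1] A1)
    qed
    show "\<bar>(A1 (x + \<epsilon>) - A1 x) / \<epsilon>\<^sup>2\<bar> \<le> L" for x
    proof -
      obtain z where "A1 (x + \<epsilon>) - A1 x = \<epsilon> * (h (z + \<epsilon>) - h z)" using mvt[OF A1] by blast
      moreover have "\<bar>h (z + \<epsilon>) - h z\<bar> \<le> L * \<epsilon>" using lip[of "z + \<epsilon>" z] \<open>\<epsilon> > 0\<close> by simp
      ultimately have "\<bar>A1 (x + \<epsilon>) - A1 x\<bar> \<le> \<epsilon> * (L * \<epsilon>)"
        using \<open>\<epsilon> > 0\<close> by (simp add: abs_mult)
      then show ?thesis
        using \<open>\<epsilon> > 0\<close> by (simp add: pos_divide_le_eq power2_eq_square ac_simps)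
    qed
    show "\<exists>y. x \<le> y \<and> y \<le> x + 2 * \<epsilon> \<and> (B1 (x + \<epsilon>) - B1 x) / \<epsilon>\<^sup>2 = h y" for x
    proof -
      obtain z where z: "x < z" "z < x + \<epsilon>" "B1 (x + \<epsilon>) - B1 x = \<epsilon> * A1 z" using mvt[OF B1] by blast
      obtain y where y: "z < y" "y < z + \<epsilon>" "A1 z = \<epsilon> * h y" using mvt[OF A] unfolding A1_def by blast
      show ?thesis using z y \<open>\<epsilon> > 0\<close> by (intro exI[of _ y]) (auto simp: power2_eq_square)
    qed
  qed
qed

text \<open>The second derivative of the double average is a difference of two first differences,
  each at most \<epsilon>, over \<open>\<epsilon>\<^sup>2\<close>. The error
  \<open>2 * \<epsilon>\<close> is the total length of the two windows.\<close>

lemma smooth_lipschitz: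
  fixes h :: "real \<Rightarrow> real"
  assumes lip: "\<And>x y. \<bar>h x - h y\<bar> \<le> \<bar>x - y\<bar>" and "\<epsilon> > 0"
  obtains g g' g'' where
    "\<And>x. (g has_real_derivative g' x) (at x)" "\<And>x. (g' has_real_derivative g'' x) (at x)"
    "continuous_on UNIV g''" "\<And>x. \<bar>g' x\<bar> \<le> 1" "\<And>x. \<bar>g'' x\<bar> \<le> 2 / \<epsilon>"
    "\<And>x. \<bar>g x - h x\<bar> \<le> 2 * \<epsilon>"
proof -
  have lip1: "\<bar>h x - h y\<bar> \<le> 1 * \<bar>x - y\<bar>" for x y using lip by simp
  have "1-lipschitz_on UNIV h" using lip by (auto simp: lipschitz_on_def dist_real_def)
  then have "continuous_on UNIV h" by (rule lipschitz_on_continuous_on)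
  then have ch: "continuous_on UNIV (\<lambda>x. h (x + a))" for a
    by (rule continuous_on_compose2) (auto intro!: continuous_intros)
  define g'' where "g'' = (\<lambda>x. ((h (x + 2 * \<epsilon>) - h (x + \<epsilon>)) - (h (x + \<epsilon>) - h x)) / \<epsilon>\<^sup>2)"
  obtain g g' where g: "\<And>x. (g has_real_derivative g' x) (at x)"
    "\<And>x. (g' has_real_derivative g'' x) (at x)" "\<And>x. \<bar>g' x\<bar> \<le> 1"
    and gh: "\<And>x. \<exists>y. x \<le> y \<and> y \<le> x + 2 * \<epsilon> \<and> g x = h y"
    using double_average[OF lip1 \<open>\<epsilon> > 0\<close>] unfolding g''_def by blast
  show ?thesis
  proof (rule that[OF g(1,2) _ g(3)])
    show "continuous_on UNIV g''"
      unfolding g''_def using ch[of 0] \<open>\<epsilon> > 0\<close> by (intro continuous_intros ch) auto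
    show "\<bar>g'' x\<bar> \<le> 2 / \<epsilon>" for x
    proof -
      have "\<bar>(h (x + 2 * \<epsilon>) - h (x + \<epsilon>)) - (h (x + \<epsilon>) - h x)\<bar> \<le> 2 * \<epsilon>"
        using lip[of "x + 2 * \<epsilon>" "x + \<epsilon>"] lip[of "x + \<epsilon>" x] \<open>\<epsilon> > 0\<close> by simp
      then have "\<bar>g'' x\<bar> \<le> (2 * \<epsilon>) / \<epsilon>\<^sup>2" 
        unfolding g''_def abs_divide abs_power2 by (rule divide_right_mono) simp
      then show ?thesis using \<open>\<epsilon> > 0\<close> by (simp add: power2_eq_square)
    qed
    show "\<bar>g x - h x\<bar> \<le> 2 * \<epsilon>" for x
    proof -
      obtain y where "x \<le> y" "y \<le> x + 2 * \<epsilon>" "g x = h y" using gh by blast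
      then show ?thesis using lip[of y x] by simp
    qed
  qed
qed

text \<open>The double average over windows of length \<open>w/4\<close> of a linear ramp of width \<open>w/2\<close>. The ramp
  being monotone, its two first differences have the same sign and the bound on \<open>g''\<close> is half of
  the one for general Lipschitz functions.\<close>

lemma smooth_step:
  fixes z w :: real
  assumes "w > 0"
  obtains g g' g'' where
    "\<And>x. (g has_real_derivative g' x) (at x)" "\<And>x. (g' has_real_derivative g'' x) (at x)"
    "continuous_on UNIV g''" "\<And>x. \<bar>g' x\<bar> \<le> 2 / w" "\<And>x. \<bar>g'' x\<bar> \<le> 8 / w\<^sup>2"
    "\<And>x. 0 \<le> g x" "\<And>x. g x \<le> 1" "\<And>x. x \<le> z \<Longrightarrow> g x = 1" "\<And>x. x \<ge> z + w \<Longrightarrow> g x = 0"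
proof -
  \<comment> \<open>The ramp is \<open>1\<close> up to \<open>z + w / 2\<close> and \<open>0\<close>
    from \<open>z + w\<close> on. The averages look to the right by at most
    \<open>2 * \<epsilon> = w / 2\<close>, so \<open>g\<close> is still \<open>1\<close> up to
    \<open>z\<close>.\<close>
  define h where "h = (\<lambda>x. max 0 (min 1 ((2 / w) * (z + w - x))))"
  have clamp: "\<bar>max 0 (min 1 a) - max 0 (min 1 b)\<bar> \<le> \<bar>a - b\<bar>" for a b :: real by linarith
  have lip: "\<bar>h x - h y\<bar> \<le> 2 / w * \<bar>x - y\<bar>" for x y
  proof -
    have "\<bar>h x - h y\<bar> \<le> \<bar>(2 / w) * (z + w - x) - (2 / w) * (z + w - y)\<bar>"
      unfolding h_def by (rule clamp)
    also have "(2 / w) * (z + w - x) - (2 / w) * (z + w - y) = 2 / w * (y - x)"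
      unfolding right_diff_distrib[symmetric] by simp
    also have "\<bar>2 / w * (y - x)\<bar> = 2 / w * \<bar>x - y\<bar>"
      unfolding abs_mult using \<open>w > 0\<close> by (simp add: abs_minus_commute)
    finally show ?thesis .
  qed
  have mono: "h y \<le> h x" if "x \<le> y" for x y
    unfolding h_def using that \<open>w > 0\<close> by (intro max.mono min.mono mult_left_mono) auto
  have ch: "continuous_on UNIV (\<lambda>x. h (x + a))" for a
    unfolding h_def by (intro continuous_intros)
  define \<epsilon> where "\<epsilon> = w / 4"
  have \<epsilon>: "\<epsilon> > 0" using \<open>w > 0\<close> by (simp add: \<epsilon>_def)
  define g'' where "g'' = (\<lambda>x. ((h (x + 2 * \<epsilon>) - h (x + \<epsilon>)) - (h (x + \<epsilon>) - h x)) / \<epsilon>\<^sup>2)"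
  obtain g g' where g: "\<And>x. (g has_real_derivative g' x) (at x)"
    "\<And>x. (g' has_real_derivative g'' x) (at x)" "\<And>x. \<bar>g' x\<bar> \<le> 2 / w"
    and gh: "\<And>x. \<exists>y. x \<le> y \<and> y \<le> x + 2 * \<epsilon> \<and> g x = h y"
    using double_average[OF lip \<epsilon>] unfolding g''_def by blast
  show ?thesis
  proof (rule that[OF g(1,2) _ g(3)])
    show "continuous_on UNIV g''"
      unfolding g''_def using ch[of 0] \<epsilon> by (intro continuous_intros ch) auto
    show "\<bar>g'' x\<bar> \<le> 8 / w\<^sup>2" for x
    proof -
      have "\<bar>h (x + 2 * \<epsilon>) - h (x + \<epsilon>)\<bar> \<le> 1 / 2" "\<bar>h (x + \<epsilon>) - h x\<bar> \<le> 1 / 2"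
        using lip[of "x + 2 * \<epsilon>" "x + \<epsilon>"] lip[of "x + \<epsilon>" x] \<open>w > 0\<close> by (simp_all add: \<epsilon>_def)
      moreover have "h (x + 2 * \<epsilon>) \<le> h (x + \<epsilon>)" "h (x + \<epsilon>) \<le> h x"
        using \<epsilon> by (auto intro!: mono)
      ultimately have "\<bar>(h (x + 2 * \<epsilon>) - h (x + \<epsilon>)) - (h (x + \<epsilon>) - h x)\<bar> \<le> 1 / 2" by linarith
      then have "\<bar>g'' x\<bar> \<le> (1 / 2) / \<epsilon>\<^sup>2"
        unfolding g''_def abs_divide abs_power2 by (rule divide_right_mono) simp
      then show ?thesis by (simp add: \<epsilon>_def power2_eq_square)
    qed
    have range: "0 \<le> h y" "h y \<le> 1" for y by (auto simp: h_def)
    show "0 \<le> g x" "g x \<le> 1" for x using gh[of x] range by auto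
    show "g x = 1" if "x \<le> z" for x
    proof -
      obtain y where y: "x \<le> y" "y \<le> x + 2 * \<epsilon>" "g x = h y" using gh by blast
      have "1 = (2 / w) * (w / 2)" using \<open>w > 0\<close> by simp
      also have "\<dots> \<le> (2 / w) * (z + w - y)"
        using y that \<open>w > 0\<close> by (intro mult_left_mono) (auto simp: \<epsilon>_def)
      finally show ?thesis using y by (simp add: h_def)
    qed
    show "g x = 0" if "x \<ge> z + w" for x
    proof -
      obtain y where y: "x \<le> y" "g x = h y" using gh by blast
      have "(2 / w) * (z + w - y) \<le> 0" using y that \<open>w > 0\<close> by (intro mult_nonneg_nonpos) auto
      then show ?thesis using y by (simp add: h_def)
    qed
  qed
qed

section \<open>The gamma law\<close>

lemma gamma_weight_nonneg: "0 \<le> gamma_weight r \<alpha> t"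
  by (simp add: gamma_weight_def)

lemma borel_measurable_gamma_weight[measurable]: "gamma_weight r \<alpha> \<in> borel_measurable borel"
  unfolding gamma_weight_def[abs_def] by measurable

text \<open>Scaling the variable by \<alpha> in Euler's integral for \<open>Gamma r\<close>.\<close>

lemma nn_integral_gamma_weight:
  assumes "r > 0" "\<alpha> > 0"
  shows "(\<integral>\<^sup>+t. ennreal (gamma_weight r \<alpha> t) \<partial>lborel) = ennreal (Gamma r / \<alpha> powr r)"
proof -
  let ?f = "\<lambda>t. ennreal (indicator {0..} t * t powr (r - 1) / exp t)"
  have "ennreal (Gamma r) = (\<integral>\<^sup>+t. ?f t \<partial>lborel)"
    by (rule Gamma_conv_nn_integral_real[OF \<open>r > 0\<close>])
  also have "\<dots> = ennreal \<alpha> * (\<integral>\<^sup>+t. ?f (0 + \<alpha> * t) \<partial>lborel)"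
    using nn_integral_real_affine[of ?f \<alpha> 0] \<open>\<alpha> > 0\<close> by simp
  also have "(\<lambda>t. ?f (0 + \<alpha> * t)) = (\<lambda>t. ennreal (\<alpha> powr (r - 1)) * ennreal (gamma_weight r \<alpha> t))"
  proof
    fix t
    have "indicator {0..} (\<alpha> * t) * (\<alpha> * t) powr (r - 1) / exp (\<alpha> * t)
        = \<alpha> powr (r - 1) * gamma_weight r \<alpha> t"
      using \<open>\<alpha> > 0\<close>
      by (cases t "0 :: real" rule: linorder_cases)
         (auto simp: gamma_weight_def powr_mult exp_minus field_simps zero_le_mult_iff)
    then show "?f (0 + \<alpha> * t) = ennreal (\<alpha> powr (r - 1)) * ennreal (gamma_weight r \<alpha> t)"
      by (simp add: ennreal_mult gamma_weight_nonneg)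
  qed
  also have "ennreal \<alpha> * (\<integral>\<^sup>+t. ennreal (\<alpha> powr (r - 1)) * ennreal (gamma_weight r \<alpha> t) \<partial>lborel)
      = ennreal (\<alpha> powr r) * (\<integral>\<^sup>+t. ennreal (gamma_weight r \<alpha> t) \<partial>lborel)"
  proof -
    have "ennreal \<alpha> * ennreal (\<alpha> powr (r - 1)) = ennreal (\<alpha> powr r)"
      using \<open>\<alpha> > 0\<close> powr_mult_base[of \<alpha> "r - 1"] by (simp flip: ennreal_mult)
    then show ?thesis by (subst nn_integral_cmult) (simp_all add: mult.assoc[symmetric])
  qed
  finally have eq: "ennreal (Gamma r) = ennreal (\<alpha> powr r) * (\<integral>\<^sup>+t. ennreal (gamma_weight r \<alpha> t) \<partial>lborel)" .
  have "(\<integral>\<^sup>+t. ennreal (gamma_weight r \<alpha> t) \<partial>lborel)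
      = ennreal (1 / \<alpha> powr r) * (ennreal (\<alpha> powr r) * (\<integral>\<^sup>+t. ennreal (gamma_weight r \<alpha> t) \<partial>lborel))"
    using \<open>\<alpha> > 0\<close> by (simp add: mult.assoc[symmetric] flip: ennreal_mult)
  also have "\<dots> = ennreal (1 / \<alpha> powr r) * ennreal (Gamma r)" using eq by simp
  also have "\<dots> = ennreal (Gamma r / \<alpha> powr r)"
    using Gamma_real_nonneg[of r] \<open>r > 0\<close> by (simp flip: ennreal_mult)
  finally show ?thesis .
qed

lemma integrable_gamma_weight:
  assumes "r > 0" "\<alpha> > 0"
  shows "integrable lborel (gamma_weight r \<alpha>)"
  by (rule integrableI_nn_integral_finite[OF _ _ nn_integral_gamma_weight[OF assms]])
     (auto simp: gamma_weight_nonneg)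

lemma Gamma_law_eq_density:
  "Gamma_law r \<alpha> = density lborel (\<lambda>x. ennreal (\<alpha> powr r / Gamma r * gamma_weight r \<alpha> x))"
  unfolding Gamma_law_def
  by (intro arg_cong[where f = "density lborel"] ext arg_cong[where f = ennreal])
     (auto simp: gamma_weight_def)

lemma Gamma_law_const_pos:
  fixes r \<alpha> :: real
  assumes "r > 0" "\<alpha> > 0"
  shows "\<alpha> powr r / Gamma r > 0"
  using assms Gamma_real_pos[OF \<open>r > 0\<close>] by simp

lemma prob_space_Gamma_law:
  assumes "r > 0" "\<alpha> > 0"
  shows "prob_space (Gamma_law r \<alpha>)"
proof
  define c where "c = \<alpha> powr r / Gamma r"
  have c: "c > 0" unfolding c_def by (rule Gamma_law_const_pos[OF assms])
  have "emeasure (Gamma_law r \<alpha>) (space (Gamma_law r \<alpha>))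
      = (\<integral>\<^sup>+t. ennreal c * ennreal (gamma_weight r \<alpha> t) \<partial>lborel)"
    unfolding Gamma_law_eq_density c_def[symmetric] using c
    by (subst emeasure_density) (auto simp: ennreal_mult gamma_weight_nonneg)
  also have "\<dots> = ennreal c * ennreal (Gamma r / \<alpha> powr r)"
    by (subst nn_integral_cmult) (simp_all add: nn_integral_gamma_weight[OF assms])
  also have "\<dots> = ennreal (c * (Gamma r / \<alpha> powr r))"
    using c Gamma_real_pos[OF \<open>r > 0\<close>] by (subst ennreal_mult) auto
  also have "c * (Gamma r / \<alpha> powr r) = 1"
  proof -
    have "Gamma r \<noteq> 0" using Gamma_real_pos[OF \<open>r > 0\<close>] by (metis less_irrefl)
    then show ?thesis using assms by (simp add: c_def)
  qed
  finally show "emeasure (Gamma_law r \<alpha>) (space (Gamma_law r \<alpha>)) = 1" by simp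
qed

lemma sets_Gamma_law[simp, measurable_cong]: "sets (Gamma_law r \<alpha>) = sets borel"
  by (simp add: Gamma_law_def)

lemma space_Gamma_law[simp]: "space (Gamma_law r \<alpha>) = UNIV"
  by (simp add: Gamma_law_def)

lemma integrable_Gamma_law_iff:
  assumes "r > 0" "\<alpha> > 0" and [measurable]: "f \<in> borel_measurable borel"
  shows "integrable (Gamma_law r \<alpha>) f \<longleftrightarrow> integrable lborel (\<lambda>t. gamma_weight r \<alpha> t * f t)"
proof -
  define c where "c = \<alpha> powr r / Gamma r"
  have c: "c > 0" unfolding c_def by (rule Gamma_law_const_pos[OF assms(1,2)])
  have "integrable (Gamma_law r \<alpha>) f
      \<longleftrightarrow> integrable lborel (\<lambda>t. c * (gamma_weight r \<alpha> t * f t))"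
    unfolding Gamma_law_eq_density c_def[symmetric] using c
    by (subst integrable_real_density) (auto simp: gamma_weight_nonneg mult.assoc)
  then show ?thesis using c by simp
qed

lemma integral_Gamma_law:
  assumes "r > 0" "\<alpha> > 0" and [measurable]: "f \<in> borel_measurable borel"
  shows "(LINT t|Gamma_law r \<alpha>. f t)
      = \<alpha> powr r / Gamma r * (LINT t|lborel. gamma_weight r \<alpha> t * f t)"
proof -
  define c where "c = \<alpha> powr r / Gamma r"
  have c: "c > 0" unfolding c_def by (rule Gamma_law_const_pos[OF assms(1,2)])
  have "(LINT t|Gamma_law r \<alpha>. f t)
      = (LINT t|lborel. c * (gamma_weight r \<alpha> t * f t))"
    unfolding Gamma_law_eq_density c_def[symmetric] using c
    by (subst integral_real_density) (auto simp: gamma_weight_nonneg mult.assoc)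
  then show ?thesis by (simp add: c_def)
qed

text \<open>Multiplication by \<open>t\<close> turns the weight of shape \<open>r\<close> into the
  one of shape \<open>r + 1\<close>, which is integrable as well.\<close>

lemma integrable_Gamma_law_ident:
  assumes "r > 0" "\<alpha> > 0"
  shows "integrable (Gamma_law r \<alpha>) (\<lambda>x. x)"
proof -
  have "(\<lambda>t. gamma_weight r \<alpha> t * t) = gamma_weight (r + 1) \<alpha>"
  proof
    fix t :: real
    have "t powr (r - 1) * t = t powr r" if "t > 0"
      using that by (simp add: powr_diff)
    then show "gamma_weight r \<alpha> t * t = gamma_weight (r + 1) \<alpha> t"
      by (auto simp: gamma_weight_def indicator_def)
  qed
  then show ?thesis
    using integrable_gamma_weight[of "r + 1" \<alpha>] assms by (simp add: integrable_Gamma_law_iff)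
qed

text \<open>For \<open>r \<ge> 1\<close> this is the supremum of the gamma density, its value at the
  mode \<open>(r - 1) / \<alpha>\<close> if \<open>r > 1\<close>. For \<open>r < 1\<close> the
  density has no upper bound, and this is the constant in front of
  \<open>t powr (r - 1)\<close>.\<close>

definition gamma_density_bound :: "real \<Rightarrow> real \<Rightarrow> real" where
  "gamma_density_bound r \<alpha> = (if r < 1 then \<alpha> powr r / Gamma r
     else \<alpha> / Gamma r * powr0 ((r - 1) / exp 1) (r - 1))"

lemma gamma_density_bound_pos:
  assumes "r > 0" "\<alpha> > 0"
  shows "gamma_density_bound r \<alpha> > 0"
  using assms Gamma_real_pos[OF \<open>r > 0\<close>] by (auto simp: gamma_density_bound_def powr0_def)

lemma gamma_density_le_of_ge_1:
  assumes "r \<ge> 1" "\<alpha> > 0"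
  shows "\<alpha> powr r / Gamma r * gamma_weight r \<alpha> t \<le> gamma_density_bound r \<alpha>"
proof (cases "t > 0")
  case False
  then show ?thesis
    using gamma_density_bound_pos[of r \<alpha>] assms by (simp add: gamma_weight_def)
next
  case True
  define s where "s = r - 1"
  have G: "Gamma r > 0" using assms by (intro Gamma_real_pos) auto
  have "(\<alpha> * t) powr s * exp (- (\<alpha> * t)) \<le> powr0 (s / exp 1) s"
  proof (cases "s = 0")
    case True
    then show ?thesis using assms \<open>t > 0\<close> by (simp add: powr0_def)
  next
    case False
    then have "s > 0" using assms by (simp add: s_def)
    have y: "\<alpha> * t > 0" "\<alpha> > 0" "t > 0" using assms \<open>t > 0\<close> by simp_all
    \<comment> \<open>The tangent of \<open>ln\<close> at \<open>1\<close>, with equality at the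
      mode \<open>\<alpha> * t = s\<close>.\<close>
    have "ln (\<alpha> * t / s) \<le> \<alpha> * t / s - 1"
      using y \<open>s > 0\<close> by (intro ln_le_minus_one) simp
    then have "s * ln (\<alpha> * t / s) \<le> s * (\<alpha> * t / s - 1)"
      using \<open>s > 0\<close> by (intro mult_left_mono) auto
    then have "s * ln (\<alpha> * t) - \<alpha> * t \<le> s * (ln s - 1)"
      using y \<open>s > 0\<close> by (simp add: ln_divide_pos right_diff_distrib)
    then have "exp (s * ln (\<alpha> * t) - \<alpha> * t) \<le> exp (s * (ln s - 1))" by simp
    moreover have "powr0 (s / exp 1) s = exp (s * (ln s - 1))"
      using \<open>s > 0\<close> by (simp add: powr0_def powr_def ln_divide_pos)
    moreover have "(\<alpha> * t) powr s * exp (- (\<alpha> * t)) = exp (s * ln (\<alpha> * t) - \<alpha> * t)"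
      using y by (simp add: powr_def exp_diff exp_minus divide_inverse)
    ultimately show ?thesis by simp
  qed
  then have "\<alpha> / Gamma r * ((\<alpha> * t) powr s * exp (- (\<alpha> * t))) \<le> gamma_density_bound r \<alpha>"
    using assms G unfolding gamma_density_bound_def s_def by (auto intro!: divide_right_mono mult_left_mono)
  moreover have "\<alpha> powr r = \<alpha> * \<alpha> powr s"
    using assms powr_mult_base[of \<alpha> s] by (simp add: s_def)
  ultimately show ?thesis
    using assms \<open>t > 0\<close> by (simp add: gamma_weight_def s_def[symmetric] powr_mult algebra_simps)
qed

text \<open>The fractions \<open>a / b\<close> and \<open>(b - a) / b\<close> sum to
  \<open>1\<close> and satisfy \<open>x \<le> x powr r\<close>, so their powers sum to at least
  \<open>1\<close>; multiply by \<open>b powr r\<close>.\<close>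

lemma powr_diff_le_powr:
  fixes a b r :: real
  assumes "0 \<le> a" "a \<le> b" "0 < r" "r \<le> 1"
  shows "b powr r - a powr r \<le> (b - a) powr r"
proof (cases "b = 0")
  case False
  then have b: "b > 0" using assms by auto
  have le: "x \<le> x powr r" if "0 \<le> x" "x \<le> 1" for x :: real
    using powr_mono'[of r 1 x] that assms by simp
  have "1 \<le> (a / b) powr r + ((b - a) / b) powr r"
    using le[of "a / b"] le[of "(b - a) / b"] assms b by (simp add: diff_divide_distrib)
  also have "\<dots> = (a powr r + (b - a) powr r) / b powr r"
    using b assms by (simp add: powr_divide add_divide_distrib)
  finally show ?thesis using b by (simp add: pos_le_divide_eq)
qed (use assms in auto)

text \<open>For \<open>r \<ge> 1\<close> the density is bounded by a constant. For
  \<open>r < 1\<close> the exponential factor is dropped and \<open>t powr (r - 1)\<close>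
  integrated; subadditivity of the power \<open>r\<close> makes the result independent of the
  position of the interval. With \<open>min r 1\<close> both cases have one form.\<close>

lemma Gamma_law_interval_le:
  assumes "r > 0" "\<alpha> > 0" "w > 0"
  shows "measure (Gamma_law r \<alpha>) {z<..z + w}
           \<le> gamma_density_bound r \<alpha> * w powr (min r 1) / min r 1"
proof -
  let ?K = "gamma_density_bound r \<alpha>"
  define c where "c = \<alpha> powr r / Gamma r"
  have c: "c > 0" unfolding c_def by (rule Gamma_law_const_pos[OF assms(1,2)])
  have K: "?K > 0" by (rule gamma_density_bound_pos[OF assms(1,2)])
  have eq: "emeasure (Gamma_law r \<alpha>) {z<..z + w}
      = (\<integral>\<^sup>+t. ennreal (c * gamma_weight r \<alpha> t) * indicator {z<..z + w} t \<partial>lborel)"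
    unfolding Gamma_law_eq_density c_def[symmetric] by (subst emeasure_density) auto
  have "emeasure (Gamma_law r \<alpha>) {z<..z + w} \<le> ennreal (?K * w powr (min r 1) / min r 1)"
  proof (cases "r < 1")
    case False
    have "emeasure (Gamma_law r \<alpha>) {z<..z + w} \<le> (\<integral>\<^sup>+t. ennreal ?K * indicator {z<..z + w} t \<partial>lborel)"
      unfolding eq c_def using False assms
      by (intro nn_integral_mono mult_right_mono ennreal_leI gamma_density_le_of_ge_1) auto
    also have "\<dots> = ennreal (?K * w)"
      using K \<open>w > 0\<close> by (simp add: nn_integral_cmult_indicator ennreal_mult)
    finally have "emeasure (Gamma_law r \<alpha>) {z<..z + w} \<le> ennreal (?K * w)" .
    moreover have "min r 1 = 1" using False by simp
    ultimately show ?thesis using \<open>w > 0\<close> by simp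
  next
    case True
    \<comment> \<open>The interval is cut down to the positive half-line; the maximum in
      \<open>b\<close> makes it degenerate, rather than reversed, when
      \<open>z + w < 0\<close>.\<close>
    define a where "a = max 0 z"
    define b where "b = max a (z + w)"
    have ab: "0 \<le> a" "a \<le> b" "b - a \<le> w" using \<open>w > 0\<close> by (auto simp: a_def b_def)
    have int: "((\<lambda>t. t powr (r - 1)) has_integral (b powr r / r - a powr r / r)) {a..b}"
    proof (rule fundamental_theorem_of_calculus_interior[OF \<open>a \<le> b\<close>])
      show "continuous_on {a..b} (\<lambda>t. t powr r / r)"
        using ab \<open>r > 0\<close> by (intro continuous_intros continuous_on_powr') auto
      show "((\<lambda>t. t powr r / r) has_vector_derivative t powr (r - 1)) (at t)" if "t \<in> {a<..<b}" for t
        using that ab \<open>r > 0\<close>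
        by (auto simp flip: has_real_derivative_iff_has_vector_derivative intro!: derivative_eq_intros)
    qed
    have "emeasure (Gamma_law r \<alpha>) {z<..z + w}
        \<le> (\<integral>\<^sup>+t. ennreal c * (ennreal (t powr (r - 1)) * indicator {a..b} t) \<partial>lborel)"
      unfolding eq
    proof (rule nn_integral_mono)
      fix t :: real
      show "ennreal (c * gamma_weight r \<alpha> t) * indicator {z<..z + w} t
          \<le> ennreal c * (ennreal (t powr (r - 1)) * indicator {a..b} t)"
      proof (cases "t > 0 \<and> t \<in> {z<..z + w}")
        case True
        then have "t \<in> {a..b}" by (auto simp: a_def b_def)
        moreover have "t powr (r - 1) * exp (- \<alpha> * t) \<le> t powr (r - 1)"
          using True \<open>\<alpha> > 0\<close> by (intro mult_left_le) auto
        ultimately show ?thesis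
          using True c by (simp add: gamma_weight_def mult_left_mono flip: ennreal_mult)
      qed (auto simp: gamma_weight_def)
    qed
    also have "\<dots> = ennreal c * ennreal (b powr r / r - a powr r / r)"
      by (subst nn_integral_cmult) (auto simp: nn_integral_has_integral_lebesgue'[OF _ int])
    also have "\<dots> \<le> ennreal c * ennreal (w powr r / r)"
    proof (intro mult_left_mono ennreal_leI)
      have "b powr r - a powr r \<le> (b - a) powr r" using ab assms True by (intro powr_diff_le_powr) auto
      also have "\<dots> \<le> w powr r" using ab assms by (intro powr_mono2) auto
      finally show "b powr r / r - a powr r / r \<le> w powr r / r"
        using \<open>r > 0\<close> by (simp add: divide_right_mono flip: diff_divide_distrib)
    qed simp
    also have "\<dots> = ennreal (c * (w powr r / r))"
      using c \<open>r > 0\<close> by (intro ennreal_mult[symmetric]) auto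
    also have "c * (w powr r / r) = ?K * w powr (min r 1) / min r 1"
      using True by (simp add: gamma_density_bound_def c_def)
    finally show ?thesis .
  qed
  then have "enn2real (emeasure (Gamma_law r \<alpha>) {z<..z + w}) \<le> ?K * w powr (min r 1) / min r 1"
    using K assms by (intro enn2real_leI) auto
  then show ?thesis by (simp add: measure_def)
qed

section \<open>Comparison with the gamma law\<close>

lemma borel_measurable_lipschitz_real:
  fixes \<phi> :: "real \<Rightarrow> real"
  assumes "\<And>x y. \<bar>\<phi> x - \<phi> y\<bar> \<le> B * \<bar>x - y\<bar>"
  shows "\<phi> \<in> borel_measurable borel"
proof -
  have "B \<ge> 0" using assms[of 1 0] by simp
  then have "B-lipschitz_on UNIV \<phi>" using assms by (auto simp: lipschitz_on_def dist_real_def)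
  then show ?thesis by (intro borel_measurable_continuous_onI lipschitz_on_continuous_on)
qed

lemma (in finite_measure) integrable_lipschitz:
  fixes \<phi> :: "real \<Rightarrow> real"
  assumes lip: "\<And>x y. \<bar>\<phi> x - \<phi> y\<bar> \<le> B * \<bar>x - y\<bar>" and X: "integrable M X"
  shows "integrable M (\<lambda>\<omega>. \<phi> (X \<omega>))"
proof (rule Bochner_Integration.integrable_bound)
  show "integrable M (\<lambda>\<omega>. \<bar>\<phi> 0\<bar> + B * \<bar>X \<omega>\<bar>)" using X by simp
  show "(\<lambda>\<omega>. \<phi> (X \<omega>)) \<in> borel_measurable M"
    using borel_measurable_lipschitz_real[OF lip] borel_measurable_integrable[OF X]
    by (rule measurable_compose_rev)
  have "\<bar>\<phi> x\<bar> \<le> \<bar>\<phi> 0\<bar> + B * \<bar>x\<bar>" for x using lip[of x 0] by simp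
  then show "AE \<omega> in M. norm (\<phi> (X \<omega>)) \<le> norm (\<bar>\<phi> 0\<bar> + B * \<bar>X \<omega>\<bar>)"
    by (intro AE_I2) (simp, smt (verit))
qed

lemma lipschitz_integral_diff_le:
  fixes \<phi> :: "real \<Rightarrow> real"
  assumes "prob_space P" "prob_space Q"
    and [measurable_cong]: "sets P = sets borel" "sets Q = sets borel"
    and P: "integrable P (\<lambda>x. x)" and Q: "integrable Q (\<lambda>x. x)"
    and lip: "\<And>x y. \<bar>\<phi> x - \<phi> y\<bar> \<le> B * \<bar>x - y\<bar>"
    and dist: "wasserstein_dist P Q \<le> ennreal \<theta>" and "\<theta> \<ge> 0"
  shows "\<bar>(LINT x|P. \<phi> x) - (LINT x|Q. \<phi> x)\<bar> \<le> B * \<theta>"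
proof -
  interpret P: prob_space P by fact
  interpret Q: prob_space Q by fact
  have "B \<ge> 0" using lip[of 1 0] by simp
  show ?thesis
  proof (cases "B = 0")
    \<comment> \<open>Rescaling to Lipschitz constant \<open>1\<close> would divide by zero, but
      then \<phi> is constant and both integrals equal its value.\<close>
    case True
    then have "\<phi> = (\<lambda>_. \<phi> 0)" using lip[of _ 0] by (intro ext) auto
    then have "(LINT x|P. \<phi> x) = \<phi> 0" "(LINT x|Q. \<phi> x) = \<phi> 0"
      using P.prob_space Q.prob_space by (metis lebesgue_integral_const scaleR_one)+
    then show ?thesis using True by simp
  next
    case False
    with \<open>B \<ge> 0\<close> have B: "B > 0" by simp
    let ?\<psi> = "\<lambda>x. \<phi> x / B"
    have int: "integrable P \<phi>" "integrable Q \<phi>"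
      using P.integrable_lipschitz[OF lip P] Q.integrable_lipschitz[OF lip Q] by simp_all
    have "\<bar>?\<psi> x - ?\<psi> y\<bar> \<le> \<bar>x - y\<bar>" for x y
      using lip[of x y] B by (simp add: pos_divide_le_eq mult.commute flip: diff_divide_distrib)
    then have "1-lipschitz_on UNIV ?\<psi>" by (auto simp: lipschitz_on_def dist_real_def)
    then have "?\<psi> \<in> {f. 1-lipschitz_on UNIV f \<and> integrable P f \<and> integrable Q f}"
      using int by simp
    from SUP_upper[OF this, of "\<lambda>f. ennreal \<bar>(LINT x|P. f x) - (LINT x|Q. f x)\<bar>"]
    have "ennreal \<bar>(LINT x|P. ?\<psi> x) - (LINT x|Q. ?\<psi> x)\<bar> \<le> ennreal \<theta>"
      using P Q dist by (simp add: wasserstein_dist_def)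
    then have "\<bar>(LINT x|P. ?\<psi> x) - (LINT x|Q. ?\<psi> x)\<bar> \<le> \<theta>"
      using \<open>\<theta> \<ge> 0\<close> by (simp add: ennreal_le_iff)
    then show ?thesis
      using B by (simp add: pos_divide_le_eq mult.commute flip: diff_divide_distrib)
  qed
qed

section \<open>Biased variables and the Stein bound\<close>

lemma (in prob_space) gamma_parameters_pos:
  fixes W :: "'a \<Rightarrow> real" and \<mu> \<sigma> \<alpha> r :: real
  assumes W_nonneg: "AE \<omega> in M. 0 \<le> W \<omega>" and W_int: "integrable M W"
    and \<mu>: "\<mu> = expectation W" and \<sigma>: "\<sigma>\<^sup>2 = variance W" "\<sigma> > 0"
    and "\<alpha> = \<mu> / \<sigma>\<^sup>2" "r = \<mu>\<^sup>2 / \<sigma>\<^sup>2"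
  shows "\<mu> > 0" "\<alpha> > 0" "r > 0"
proof -
  have "\<mu> \<ge> 0" unfolding \<mu> using W_nonneg by (rule integral_nonneg_AE)
  moreover have "\<mu> \<noteq> 0"
  proof
    assume "\<mu> = 0"
    then have "AE \<omega> in M. W \<omega> = 0"
      using integral_nonneg_eq_0_iff_AE[OF W_int W_nonneg] \<mu> by simp
    then have "variance W = (\<integral>\<omega>. 0 \<partial>M)"
      using \<open>\<mu> = 0\<close> \<mu> W_int by (intro integral_cong_AE) auto
    then show False using \<sigma> by simp
  qed
  ultimately show "\<mu> > 0" by simp
  with assms(6,7) \<sigma>(2) show "\<alpha> > 0" "r > 0" by simp_all
qed

text \<open>A real \<theta> bounding the distance keeps all estimates within real arithmetic.
  Infinite \<Theta> is treated separately at the end.\<close>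

locale gamma_biased = M: prob_space M + N1: prob_space N1 + N2: prob_space N2
  for M :: "'a measure" and N1 :: "'b measure" and N2 :: "'c measure" +
  fixes W :: "'a \<Rightarrow> real" and Ws :: "'b \<Rightarrow> real" and Wz :: "'c \<Rightarrow> real"
    and \<mu> \<sigma> \<alpha> r \<theta> :: real
  assumes W[measurable]: "W \<in> borel_measurable M" and Ws[measurable]: "Ws \<in> borel_measurable N1"
    and Wz[measurable]: "Wz \<in> borel_measurable N2"
    and W_nonneg: "AE \<omega> in M. 0 \<le> W \<omega>"
    and W_int: "integrable M W" and \<mu>_def: "\<mu> = M.expectation W"
    and W2_int: "integrable M (\<lambda>\<omega>. (W \<omega>)\<^sup>2)" and \<sigma>_eq: "\<sigma>\<^sup>2 = M.variance W" and \<sigma>_pos: "\<sigma> > 0"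
    and size_biased: "size_biased M W N1 Ws"
    and zero_biased: "zero_biased M W N2 Wz"
    and \<alpha>_def: "\<alpha> = \<mu> / \<sigma>\<^sup>2" and r_def: "r = \<mu>\<^sup>2 / \<sigma>\<^sup>2"
    and \<theta>_nonneg: "0 \<le> \<theta>"
    and dist: "wasserstein_dist (distr N1 borel Ws) (distr N2 borel Wz) \<le> ennreal \<theta>"
begin

lemma \<mu>_pos: "\<mu> > 0" and \<alpha>_pos: "\<alpha> > 0" and r_pos: "r > 0"
  using M.gamma_parameters_pos[OF W_nonneg W_int \<mu>_def \<sigma>_eq \<sigma>_pos \<alpha>_def r_def] by simp_all

lemma \<alpha>_mult_\<mu>: "\<alpha> * \<mu> = r" and \<alpha>_mult_\<sigma>: "\<alpha> * \<sigma>\<^sup>2 = \<mu>"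
  using \<sigma>_pos by (auto simp: \<alpha>_def r_def power2_eq_square)

text \<open>The second moment of \<open>W\<close> is the first moment of \<open>Ws\<close> up to the
  factor \<mu>: the test function is the identity.\<close>

lemma Ws_int: "integrable N1 Ws"
  using size_biased W2_int
  by (auto simp: size_biased_def power2_eq_square dest!: bspec[of _ _ "\<lambda>x. x"])

text \<open>Finiteness of the distance provides this moment: \<open>Ws\<close> has one, so if
  \<open>Wz\<close> had none, the distance would be infinite by definition.\<close>

lemma Wz_int: "integrable N2 Wz"
proof (rule ccontr)
  assume "\<not> integrable N2 Wz"
  then have "wasserstein_dist (distr N1 borel Ws) (distr N2 borel Wz) = \<infinity>"
    using Ws_int by (simp add: wasserstein_dist_def integrable_distr_eq)
  with dist show False by (simp add: top_unique)
qed

lemma stein_bound: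
  fixes h h' h'' :: "real \<Rightarrow> real"
  assumes h: "\<And>y. (h has_real_derivative h' y) (at y)"
    and h': "\<And>y. (h' has_real_derivative h'' y) (at y)"
    and h'': "continuous_on UNIV h''"
    and H1: "\<And>y. \<bar>h' y\<bar> \<le> H\<^sub>1" and H2: "\<And>y. \<bar>h'' y\<bar> \<le> H\<^sub>2"
  shows "\<bar>M.expectation (\<lambda>\<omega>. h (W \<omega>)) - (LINT x|Gamma_law r \<alpha>. h x)\<bar>
           \<le> \<mu> * ((2 * H\<^sub>2 + 4 * \<alpha> * H\<^sub>1) / (r + 2) * \<theta>)"
proof -
  interpret G: prob_space "Gamma_law r \<alpha>" by (rule prob_space_Gamma_law[OF r_pos \<alpha>_pos])
  define B where "B = (2 * H\<^sub>2 + 4 * \<alpha> * H\<^sub>1) / (r + 2)"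
  have lip_h: "\<bar>h x - h y\<bar> \<le> H\<^sub>1 * \<bar>x - y\<bar>" for x y
    by (rule deriv_le_imp_diff_le[OF h, of "min x y"]) (use H1 in auto)
  have h_meas[measurable]: "h \<in> borel_measurable borel" by (rule borel_measurable_lipschitz_real[OF lip_h])
  have hG: "integrable (Gamma_law r \<alpha>) h"
    using G.integrable_lipschitz[OF lip_h integrable_Gamma_law_ident[OF r_pos \<alpha>_pos]] by simp
  have hW: "integrable M (\<lambda>\<omega>. h (W \<omega>))" by (rule M.integrable_lipschitz[OF lip_h W_int])
  define c where "c = (LINT x|Gamma_law r \<alpha>. h x)"
  define k where "k = (\<lambda>x. h x - c)"
  have k_meas[measurable]: "k \<in> borel_measurable borel" unfolding k_def by measurable
  have kG: "integrable (Gamma_law r \<alpha>) k" unfolding k_def using hG by simp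
  have k0: "(LINT x|Gamma_law r \<alpha>. k x) = 0"
    unfolding k_def using hG G.prob_space by (simp add: c_def)
  have k: "(k has_real_derivative h' y) (at y)" for y
    unfolding k_def by (auto intro!: derivative_eq_intros h)
  have int: "integrable lborel (\<lambda>t. gamma_weight r \<alpha> t * k t)"
    using kG by (simp add: integrable_Gamma_law_iff[OF r_pos \<alpha>_pos])
  have mean: "(LINT t|lborel. gamma_weight r \<alpha> t * k t) = 0"
    using k0 Gamma_law_const_pos[OF r_pos \<alpha>_pos]
    unfolding integral_Gamma_law[OF r_pos \<alpha>_pos k_meas] by (metis less_irrefl mult_eq_0_iff)
  obtain f f' C where f: "\<And>x. (f has_real_derivative f' x) (at x)"
    and ode: "\<And>x. x * f' x + (r - \<alpha> * x) * f x = k x"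
    and fC: "\<And>x. x \<ge> 0 \<Longrightarrow> \<bar>f x\<bar> \<le> C"
    and lip': "\<And>x y. x \<ge> 0 \<Longrightarrow> y \<ge> 0 \<Longrightarrow> \<bar>f' x - f' y\<bar> \<le> B * \<bar>x - y\<bar>"
    using gamma_stein_solution[OF r_pos \<alpha>_pos k h' h'' H1 H2 int mean] unfolding B_def by blast
  have B0: "B \<ge> 0" using lip'[of 1 0] by simp
  \<comment> \<open>For negative arguments, which \<open>W\<close> does not take, \<open>f\<close> is replaced by an affine function, so that
    the derivative is Lipschitz on the whole line.\<close>
  define F' where "F' = (\<lambda>x. f' (max 0 x))"
  have lip_F': "\<bar>F' x - F' y\<bar> \<le> B * \<bar>x - y\<bar>" for x y
  proof -
    have "\<bar>F' x - F' y\<bar> \<le> B * \<bar>max 0 x - max 0 y\<bar>" unfolding F'_def by (intro lip') auto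
    also have "\<dots> \<le> B * \<bar>x - y\<bar>" using B0 by (intro mult_left_mono) auto
    finally show ?thesis .
  qed
  have F'_meas[measurable]: "F' \<in> borel_measurable borel"
    by (rule borel_measurable_lipschitz_real[OF lip_F'])
  have "B-lipschitz_on UNIV F'" using lip_F' B0 by (auto simp: lipschitz_on_def dist_real_def)
  then obtain F0 where F0: "\<And>x. (F0 has_real_derivative F' x) (at x)"
    using antiderivative_real lipschitz_on_continuous_on by blast
  define F where "F = (\<lambda>x. F0 x - F0 0 + f 0)"
  have F: "(F has_real_derivative F' x) (at x)" for x
    unfolding F_def by (auto intro!: derivative_eq_intros F0)
  \<comment> \<open>The difference of \<open>F\<close> and \<open>f\<close> has derivative
    \<open>0\<close> for \<open>x > 0\<close> and vanishes at \<open>0\<close>, hence the Lipschitz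
    constant \<open>0\<close>.\<close>
  have F_eq: "F x = f x" if "x \<ge> 0" for x
  proof -
    have "\<bar>(F x - f x) - (F 0 - f 0)\<bar> \<le> 0 * \<bar>x - 0\<bar>"
      by (rule deriv_le_imp_diff_le[of "\<lambda>x. F x - f x" "\<lambda>x. F' x - f' x" 0])
         (use that in \<open>auto intro!: DERIV_diff[OF F f]\<close>, simp add: F'_def)
    then show ?thesis by (simp add: F_def)
  qed
  have "continuous_on UNIV F"
    using F by (auto intro!: DERIV_continuous_on intro: has_field_derivative_at_within)
  then have F_meas[measurable]: "F \<in> borel_measurable borel" by (rule borel_measurable_continuous_onI)
  have dF: "deriv F = F'" using F by (auto simp: DERIV_imp_deriv)
  have F_diff: "F differentiable_on UNIV"
    using F by (auto simp: differentiable_on_def real_differentiable_def)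

  \<comment> \<open>\<open>F'\<close> grows at most linearly, so the second moment of
    \<open>W\<close> dominates this product. \<open>F\<close> is bounded by \<open>C\<close> on the
    range of \<open>W\<close>, so the first moment suffices for the products with
    \<open>F\<close>.\<close>
  have int1: "integrable M (\<lambda>\<omega>. W \<omega> * F' (W \<omega>))"
  proof (rule Bochner_Integration.integrable_bound)
    show "integrable M (\<lambda>\<omega>. \<bar>F' 0\<bar> * \<bar>W \<omega>\<bar> + B * (W \<omega>)\<^sup>2)" using W_int W2_int by simp
    have "\<bar>x * F' x\<bar> \<le> \<bar>F' 0\<bar> * \<bar>x\<bar> + B * x\<^sup>2" for x
    proof -
      have "\<bar>F' x\<bar> \<le> \<bar>F' 0\<bar> + B * \<bar>x\<bar>" using lip_F'[of x 0] by simp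
      from mult_left_mono[OF this, of "\<bar>x\<bar>"] show ?thesis
        by (simp add: abs_mult power2_eq_square algebra_simps)
    qed
    moreover have "\<bar>F' 0\<bar> * \<bar>x\<bar> + B * x\<^sup>2 \<ge> 0" for x using B0 by simp
    ultimately show "AE \<omega> in M. norm (W \<omega> * F' (W \<omega>)) \<le> norm (\<bar>F' 0\<bar> * \<bar>W \<omega>\<bar> + B * (W \<omega>)\<^sup>2)"
      by (intro AE_I2) (simp del: abs_mult)
  qed simp
  have int2: "integrable M (\<lambda>\<omega>. W \<omega> * F (W \<omega>))"
  proof (rule Bochner_Integration.integrable_bound)
    show "integrable M (\<lambda>\<omega>. C * W \<omega>)" using W_int by simp
    show "AE \<omega> in M. norm (W \<omega> * F (W \<omega>)) \<le> norm (C * W \<omega>)"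
      using W_nonneg
    proof eventually_elim
      case (elim \<omega>)
      have "C \<ge> 0" using fC[of 0] by simp
      then show ?case
        using mult_left_mono[OF fC[OF elim] elim] elim by (simp add: F_eq abs_mult mult.commute)
    qed
  qed simp
  have int3: "integrable M (\<lambda>\<omega>. F (W \<omega>))"
  proof (rule Bochner_Integration.integrable_bound)
    show "integrable M (\<lambda>\<omega>. C)" by simp
    show "AE \<omega> in M. norm (F (W \<omega>)) \<le> norm C"
      using W_nonneg by eventually_elim (use fC in \<open>force simp: F_eq\<close>)
  qed simp
  have int4: "integrable M (\<lambda>\<omega>. (W \<omega> - \<mu>) * F (W \<omega>))"
    using int2 int3 by (simp add: left_diff_distrib)
  have s: "(\<integral>\<omega>. W \<omega> * F' (W \<omega>) \<partial>M) = \<mu> * (\<integral>\<omega>. F' (Ws \<omega>) \<partial>N1)"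
    using size_biased int1 F'_meas unfolding size_biased_def \<mu>_def by blast
  have z: "(\<integral>\<omega>. (W \<omega> - \<mu>) * F (W \<omega>) \<partial>M) = \<sigma>\<^sup>2 * (\<integral>\<omega>. F' (Wz \<omega>) \<partial>N2)"
    using zero_biased F_diff int2 N2.integrable_lipschitz[OF lip_F' Wz_int]
    unfolding zero_biased_def \<mu>_def \<sigma>_eq dF[symmetric] by blast
  have "M.expectation (\<lambda>\<omega>. h (W \<omega>)) - c = (\<integral>\<omega>. k (W \<omega>) \<partial>M)"
    unfolding k_def using hW M.prob_space by simp
  \<comment> \<open>\<open>\<alpha> * \<mu> = r\<close> turns \<open>r - \<alpha> * W\<close> into
    \<open>- \<alpha> * (W - \<mu>)\<close>, the centered form on which zero bias acts; afterwards
    \<open>\<alpha> * \<sigma>\<^sup>2 = \<mu>\<close> gives both biased expectations the same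
    factor.\<close>
  also have "\<dots> = (\<integral>\<omega>. W \<omega> * F' (W \<omega>) - \<alpha> * ((W \<omega> - \<mu>) * F (W \<omega>)) \<partial>M)"
  proof (rule integral_cong_AE)
    show "AE \<omega> in M. k (W \<omega>) = W \<omega> * F' (W \<omega>) - \<alpha> * ((W \<omega> - \<mu>) * F (W \<omega>))"
      using W_nonneg
    proof eventually_elim
      case (elim \<omega>)
      then show ?case
        using ode[of "W \<omega>"] by (simp add: F_eq F'_def algebra_simps flip: \<alpha>_mult_\<mu>)
    qed
  qed auto
  also have "\<dots> = \<mu> * (\<integral>\<omega>. F' (Ws \<omega>) \<partial>N1) - \<alpha> * (\<sigma>\<^sup>2 * (\<integral>\<omega>. F' (Wz \<omega>) \<partial>N2))"
    using int1 int4 s z by simp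
  also have "\<dots> = \<mu> * ((\<integral>\<omega>. F' (Ws \<omega>) \<partial>N1) - (\<integral>\<omega>. F' (Wz \<omega>) \<partial>N2))"
    by (simp add: right_diff_distrib mult.assoc[symmetric] \<alpha>_mult_\<sigma>)
  finally have eq: "M.expectation (\<lambda>\<omega>. h (W \<omega>)) - c
      = \<mu> * ((\<integral>\<omega>. F' (Ws \<omega>) \<partial>N1) - (\<integral>\<omega>. F' (Wz \<omega>) \<partial>N2))" .
  have "\<bar>(LINT x|distr N1 borel Ws. F' x) - (LINT x|distr N2 borel Wz. F' x)\<bar> \<le> B * \<theta>"
    by (rule lipschitz_integral_diff_le[OF _ _ _ _ _ _ lip_F' dist \<theta>_nonneg])
       (use Ws_int Wz_int in \<open>auto intro: N1.prob_space_distr N2.prob_space_distr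
          simp: integrable_distr_eq\<close>)
  then have "\<bar>(\<integral>\<omega>. F' (Ws \<omega>) \<partial>N1) - (\<integral>\<omega>. F' (Wz \<omega>) \<partial>N2)\<bar> \<le> B * \<theta>"
    by (simp add: integral_distr)
  from mult_left_mono[OF this, of \<mu>] \<mu>_pos show ?thesis
    unfolding c_def[symmetric] eq abs_mult B_def[symmetric] by simp
qed

end

section \<open>Choice of the smoothing width\<close>

lemma wasserstein_optimize:
  fixes A \<theta> y c :: real
  assumes "A > 0" "\<theta> \<ge> 0"
    and le: "\<And>\<epsilon>. \<epsilon> > 0 \<Longrightarrow> y \<le> c + 4 * A * \<theta> / \<epsilon> + 4 * \<epsilon>"
  shows "y \<le> c + 8 * sqrt (A * \<theta>)"
proof (cases "\<theta> = 0")
  \<comment> \<open>The balancing width used below would be \<open>0\<close>, so arbitrarily small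
    positive widths are taken instead.\<close>
  case True
  have "y \<le> c + e" if "e > 0" for e using le[of "e / 4"] that True by simp
  then show ?thesis using True by (simp add: field_le_epsilon)
next
  case False
  \<comment> \<open>At \<open>\<epsilon> = sqrt (A * \<theta>)\<close> both terms that depend on
    \<epsilon> equal \<open>4 * sqrt (A * \<theta>)\<close>.\<close>
  then have p: "A * \<theta> > 0" using assms by simp
  have "A * \<theta> / sqrt (A * \<theta>) = sqrt (A * \<theta>)" using p by (simp add: real_div_sqrt)
  then have "4 * A * \<theta> / sqrt (A * \<theta>) = 4 * sqrt (A * \<theta>)" by (metis mult.assoc times_divide_eq_right)
  then show ?thesis using le[of "sqrt (A * \<theta>)"] p by simp
qed

text \<open>The window width \<open>w = (48 A \<theta> / K)\<^bsup>1/(\<rho>+2)\<^esup>\<close> minimizes the sum of the terms with \<open>K\<close> and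
  with \<open>24 A \<theta>\<close>.\<close>

lemma kolmogorov_optimize:
  fixes A K \<rho> \<theta> \<alpha> y :: real
  assumes "A > 0" "K > 0" "0 < \<rho>" "\<theta> \<ge> 0"
    and le: "\<And>w. w > 0 \<Longrightarrow> y \<le> K * w powr \<rho> / \<rho> + (24 * A / w\<^sup>2 + 8 * \<alpha> * A / w) * \<theta>"
  shows "y \<le> (1 / 2 + 1 / \<rho>) * (48 * A) powr (\<rho> / (\<rho> + 2)) * K powr (2 / (\<rho> + 2)) * \<theta> powr (\<rho> / (\<rho> + 2))
    + 8 * \<alpha> * A powr ((\<rho> + 1) / (\<rho> + 2)) * (K / 48) powr (1 / (\<rho> + 2)) * \<theta> powr ((\<rho> + 1) / (\<rho> + 2))"
proof (cases "\<theta> = 0")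
  case True
  have "((\<lambda>w. K * w powr \<rho> / \<rho>) \<longlongrightarrow> 0) (at_right 0)" using \<open>0 < \<rho>\<close> by real_asymp
  then have "y \<le> 0"
    by (rule tendsto_lowerbound)
       (use le True in \<open>auto simp: eventually_at_right_field intro!: exI[of _ 1]\<close>)
  then show ?thesis using True by simp
next
  case False
  \<comment> \<open>In logarithms the products of powers become linear expressions, and
    \<open>L\<close> below is the logarithm of the width \<open>w\<close>.\<close>
  obtain a k t n :: real where e: "A = exp a" "K = exp k" "\<theta> = exp t" "48 = exp n"
    using assms False by (metis exp_ln le_neq_trans zero_less_numeral)
  define L where "L = (n + a + t - k) / (\<rho> + 2)"
  define w where "w = exp L"
  have "(\<rho> + 2) * L = n + a + t - k" using \<open>\<rho> > 0\<close> by (simp add: L_def)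
  then have L: "n + a + t - k = \<rho> * L + 2 * L" by (simp add: algebra_simps)
  have 1: "K * w powr \<rho>
      = (48 * A) powr (\<rho> / (\<rho> + 2)) * K powr (2 / (\<rho> + 2)) * \<theta> powr (\<rho> / (\<rho> + 2))"
    (is "_ = ?R")
  proof -
    have "?R = exp ((n + a) * (\<rho> / (\<rho> + 2)) + k * (2 / (\<rho> + 2)) + t * (\<rho> / (\<rho> + 2)))"
      unfolding e by (simp add: powr_def mult_exp_exp mult.commute)
    also have "(n + a) * (\<rho> / (\<rho> + 2)) + k * (2 / (\<rho> + 2)) + t * (\<rho> / (\<rho> + 2)) = k + \<rho> * L"
      using \<open>\<rho> > 0\<close> by (simp add: L_def divide_simps) (simp add: algebra_simps)
    finally show ?thesis by (simp add: e w_def powr_def exp_add)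
  qed
  \<comment> \<open>Stationarity of \<open>w\<close> makes this term one half of
    \<open>K * w powr \<rho>\<close>, which accounts for the \<open>1 / 2\<close> in the factor
    \<open>1 / 2 + 1 / \<rho>\<close>.\<close>
  have 2: "24 * A / w\<^sup>2 * \<theta> = K * w powr \<rho> / 2"
  proof -
    have "48 * A * \<theta> = K * w powr \<rho> * w\<^sup>2"
      unfolding e w_def powr_def using L
      by (simp add: exp_add[symmetric] power2_eq_square algebra_simps)
    then show ?thesis by (simp add: w_def field_simps)
  qed
  have 3: "A / w * \<theta>
      = A powr ((\<rho> + 1) / (\<rho> + 2)) * (K / 48) powr (1 / (\<rho> + 2)) * \<theta> powr ((\<rho> + 1) / (\<rho> + 2))"
    (is "_ = ?R")
  proof -
    have "?R = exp (a * ((\<rho> + 1) / (\<rho> + 2)) + (k - n) * (1 / (\<rho> + 2)) + t * ((\<rho> + 1) / (\<rho> + 2)))"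
      unfolding e exp_diff[symmetric] by (simp add: powr_def exp_add mult.commute)
    also have "a * ((\<rho> + 1) / (\<rho> + 2)) + (k - n) * (1 / (\<rho> + 2)) + t * ((\<rho> + 1) / (\<rho> + 2))
        = a - L + t"
      using \<open>\<rho> > 0\<close> by (simp add: L_def divide_simps) (simp add: algebra_simps)
    finally show ?thesis by (simp add: e w_def exp_add exp_diff)
  qed
  have "y \<le> K * w powr \<rho> / \<rho> + (24 * A / w\<^sup>2 + 8 * \<alpha> * A / w) * \<theta>"
    by (rule le) (simp add: w_def)
  also have "\<dots> = (1 / 2 + 1 / \<rho>) * (K * w powr \<rho>) + 8 * \<alpha> * (A / w * \<theta>)"
    using 2 by (simp add: algebra_simps)
  finally show ?thesis unfolding 1 3 by (simp add: mult.assoc)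
qed

text \<open>Both branches of the coefficient are instances of one formula in \<open>min r 1\<close>:
  at \<rho> = 1 the factor \<open>3 / 2\<close> and the cube root of \<open>48 = 8 * 6\<close>
  combine to \<open>3\<close> times the cube root of \<open>6\<close>.\<close>

lemma coeff_a_eq:
  assumes "r > 0" "\<mu> > 0" "\<alpha> > 0"
  defines "\<rho> \<equiv> min r 1"
  shows "coeff_a \<mu> r \<alpha> = (1 / 2 + 1 / \<rho>) * (48 * (\<mu> / (r + 2))) powr (\<rho> / (\<rho> + 2))
    * gamma_density_bound r \<alpha> powr (2 / (\<rho> + 2))"
proof (cases "r < 1")
  case False
  have "(48 * (\<mu> / (r + 2))) powr (1 / 3) = (2 ^ 3 * (6 * \<mu> / (r + 2))) powr (1 / 3)" by simp
  also have "\<dots> = (2 ^ 3) powr (1 / 3) * (6 * \<mu> / (r + 2)) powr (1 / 3)"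
    using assms by (intro powr_mult)
  also have "(2 ^ 3 :: real) powr (1 / 3) = 2" by (simp add: powr_powr flip: powr_numeral)
  finally have "(48 * (\<mu> / (r + 2))) powr (1 / 3) = 2 * (6 * \<mu> / (r + 2)) powr (1 / 3)" .
  moreover have "\<rho> = 1" using False by (simp add: \<rho>_def)
  ultimately show ?thesis using False by (simp add: coeff_a_def gamma_density_bound_def)
qed (simp add: coeff_a_def gamma_density_bound_def \<rho>_def)

text \<open>Again one formula serves both branches: at \<rho> = 1 the cube root of
  \<open>1 / 48\<close> is half that of \<open>1 / 6\<close>, which reduces \<open>8\<close> to
  \<open>4\<close>.\<close>

lemma coeff_b_eq:
  assumes "r > 0" "\<mu> > 0" "\<alpha> > 0"
  defines "\<rho> \<equiv> min r 1"
  shows "coeff_b \<mu> r \<alpha> = 8 * \<alpha> * (\<mu> / (r + 2)) powr ((\<rho> + 1) / (\<rho> + 2))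
    * (gamma_density_bound r \<alpha> / 48) powr (1 / (\<rho> + 2))"
proof (cases "r < 1")
  case False
  let ?K = "gamma_density_bound r \<alpha>"
  have K: "?K > 0" using gamma_density_bound_pos assms by simp
  have "(?K / 6) powr (1 / 3) = (2 ^ 3 * (?K / 48)) powr (1 / 3)" by simp
  also have "\<dots> = (2 ^ 3) powr (1 / 3) * (?K / 48) powr (1 / 3)"
    using K by (intro powr_mult)
  also have "(2 ^ 3 :: real) powr (1 / 3) = 2" by (simp add: powr_powr flip: powr_numeral)
  finally have K: "(?K / 6) powr (1 / 3) = 2 * (?K / 48) powr (1 / 3)" .
  have "\<alpha> / (6 * Gamma r) * powr0 ((r - 1) / exp 1) (r - 1) = ?K / 6"
    using False by (simp add: gamma_density_bound_def)
  then have "coeff_b \<mu> r \<alpha> = 4 * \<alpha> * (\<mu> / (r + 2)) powr (2 / 3) * (?K / 6) powr (1 / 3)"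
    using False by (simp only: coeff_b_def if_False)
  moreover have "\<rho> = 1" using False by (simp add: \<rho>_def)
  ultimately show ?thesis unfolding K by simp
qed (simp add: coeff_b_def gamma_density_bound_def \<rho>_def mult.commute)

section \<open>Bounds on the two distances\<close>

context gamma_biased
begin

lemma wasserstein_test_function_bound:
  assumes "1-lipschitz_on UNIV (h :: real \<Rightarrow> real)" "\<epsilon> > 0"
  shows "\<bar>M.expectation (\<lambda>\<omega>. h (W \<omega>)) - (LINT x|Gamma_law r \<alpha>. h x)\<bar>
    \<le> 4 * r / (r + 2) * \<theta> + 4 * (\<mu> / (r + 2)) * \<theta> / \<epsilon> + 4 * \<epsilon>"
proof -
  interpret G: prob_space "Gamma_law r \<alpha>" by (rule prob_space_Gamma_law[OF r_pos \<alpha>_pos])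
  have lip: "\<bar>h x - h y\<bar> \<le> \<bar>x - y\<bar>" for x y
    using assms by (auto simp: lipschitz_on_def dist_real_def)
  obtain g g' g'' where g: "\<And>x. (g has_real_derivative g' x) (at x)"
      "\<And>x. (g' has_real_derivative g'' x) (at x)" "continuous_on UNIV g''"
      "\<And>x. \<bar>g' x\<bar> \<le> 1" "\<And>x. \<bar>g'' x\<bar> \<le> 2 / \<epsilon>" and gh: "\<And>x. \<bar>g x - h x\<bar> \<le> 2 * \<epsilon>"
    using smooth_lipschitz[OF lip \<open>\<epsilon> > 0\<close>] by blast
  have lip_h: "\<bar>h x - h y\<bar> \<le> 1 * \<bar>x - y\<bar>" for x y using lip by simp
  have lip_g: "\<bar>g x - g y\<bar> \<le> 1 * \<bar>x - y\<bar>" for x y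
    by (rule deriv_le_imp_diff_le[OF g(1), of "min x y"]) (use g(4) in auto)
  \<comment> \<open>Smoothing costs \<open>2 * \<epsilon>\<close> under each of the two laws, hence
    the \<open>4 * \<epsilon>\<close> in the claim.\<close>
  have close: "\<bar>(\<integral>\<omega>. h (X \<omega>) \<partial>P) - (\<integral>\<omega>. g (X \<omega>) \<partial>P)\<bar> \<le> 2 * \<epsilon>"
    if "prob_space P" "integrable P X" for P :: "'d measure" and X
  proof -
    interpret P: prob_space P by fact
    note int = P.integrable_lipschitz[OF lip_h that(2)] P.integrable_lipschitz[OF lip_g that(2)]
    have "(\<integral>\<omega>. \<bar>h (X \<omega>) - g (X \<omega>)\<bar> \<partial>P) \<le> (\<integral>\<omega>. 2 * \<epsilon> \<partial>P)"
    proof (rule integral_mono)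
      show "\<bar>h (X \<omega>) - g (X \<omega>)\<bar> \<le> 2 * \<epsilon>" for \<omega>
        using gh[of "X \<omega>"] by (simp only: abs_minus_commute)
    qed (use int in auto)
    then have "\<bar>(\<integral>\<omega>. h (X \<omega>) - g (X \<omega>) \<partial>P)\<bar> \<le> (\<integral>\<omega>. 2 * \<epsilon> \<partial>P)"
      by (rule order_trans[OF integral_abs_bound])
    then show ?thesis using int P.prob_space by simp
  qed
  have "\<bar>M.expectation (\<lambda>\<omega>. g (W \<omega>)) - (LINT x|Gamma_law r \<alpha>. g x)\<bar>
      \<le> \<mu> * ((2 * (2 / \<epsilon>) + 4 * \<alpha> * 1) / (r + 2) * \<theta>)"
    by (rule stein_bound[OF g])
  also have "\<dots> = 4 * (\<alpha> * \<mu>) / (r + 2) * \<theta> + 4 * (\<mu> / (r + 2)) * \<theta> / \<epsilon>"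
    by (simp add: add_divide_distrib algebra_simps)
  also note \<alpha>_mult_\<mu>
  finally show ?thesis
    using close[OF M.prob_space_axioms W_int]
      close[OF G.prob_space_axioms integrable_Gamma_law_ident[OF r_pos \<alpha>_pos]] by linarith
qed

theorem wasserstein_bound:
  "wasserstein_dist (distr M borel W) (Gamma_law r \<alpha>)
     \<le> ennreal (8 * sqrt (3 * \<mu> / (r + 2)) * \<theta> powr (1 / 2) + 8 * r / (r + 2) * \<theta>)"
proof -
  have "ennreal \<bar>(LINT x|distr M borel W. h x) - (LINT x|Gamma_law r \<alpha>. h x)\<bar>
      \<le> ennreal (8 * sqrt (3 * \<mu> / (r + 2)) * \<theta> powr (1 / 2) + 8 * r / (r + 2) * \<theta>)"
    if h: "1-lipschitz_on UNIV h" for h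
  proof -
    have A: "\<mu> / (r + 2) > 0" using \<mu>_pos r_pos by simp
    have [measurable]: "h \<in> borel_measurable borel"
      by (intro borel_measurable_continuous_onI lipschitz_on_continuous_on[OF h])
    have "\<bar>(LINT x|distr M borel W. h x) - (LINT x|Gamma_law r \<alpha>. h x)\<bar>
        \<le> 4 * r / (r + 2) * \<theta> + 8 * sqrt (\<mu> / (r + 2) * \<theta>)"
      using wasserstein_optimize[OF A \<theta>_nonneg wasserstein_test_function_bound[OF h]]
      by (simp add: integral_distr)
    \<comment> \<open>The optimized bound is enlarged to the stated one: by a factor
      \<open>3\<close> under the root and by a factor \<open>2\<close> in the linear term.\<close>
    also have "\<dots> \<le> 8 * sqrt (3 * \<mu> / (r + 2)) * \<theta> powr (1 / 2) + 8 * r / (r + 2) * \<theta>"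
    proof -
      have "sqrt (\<mu> / (r + 2) * \<theta>) \<le> sqrt (3 * \<mu> / (r + 2) * \<theta>)"
        using \<mu>_pos r_pos \<theta>_nonneg by (intro real_sqrt_le_mono mult_right_mono divide_right_mono) auto
      also have "\<dots> = sqrt (3 * \<mu> / (r + 2)) * \<theta> powr (1 / 2)"
        using \<theta>_nonneg by (simp only: real_sqrt_mult powr_half_sqrt)
      moreover have "4 * r / (r + 2) * \<theta> \<le> 8 * r / (r + 2) * \<theta>"
        using r_pos \<theta>_nonneg by (intro mult_right_mono divide_right_mono) auto
      ultimately show ?thesis by linarith
    qed
    finally show ?thesis by (rule ennreal_leI)
  qed
  moreover have "integrable (distr M borel W) (\<lambda>x. x)"
    using W_int by (simp add: integrable_distr_eq)
  moreover note integrable_Gamma_law_ident[OF r_pos \<alpha>_pos]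
  ultimately show ?thesis
    unfolding wasserstein_dist_def by (auto intro: SUP_least)
qed

text \<open>A smooth step lies between the indicators of \<open>{..y}\<close> and
  \<open>{..y + w}\<close>, so comparing its two expectations compares distribution functions up to
  a shift by \<open>w\<close>. In both directions the shift is undone under the gamma law, whose
  interval probabilities are known; nothing is asked of the law of \<open>W\<close>.\<close>

lemma cdf_diff_bound:
  assumes "w > 0"
  shows "\<bar>cdf (distr M borel W) z - cdf (Gamma_law r \<alpha>) z\<bar>
    \<le> gamma_density_bound r \<alpha> * w powr (min r 1) / min r 1
      + (24 * (\<mu> / (r + 2)) / w\<^sup>2 + 8 * \<alpha> * (\<mu> / (r + 2)) / w) * \<theta>"
proof -
  define P where "P = distr M borel W"
  define Q where "Q = Gamma_law r \<alpha>"
  interpret P: prob_space P unfolding P_def by (rule M.prob_space_distr) simp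
  interpret Q: prob_space Q unfolding Q_def by (rule prob_space_Gamma_law[OF r_pos \<alpha>_pos])
  have sets[measurable_cong]: "sets P = sets borel" "sets Q = sets borel" by (simp_all add: P_def Q_def)
  have space: "space P = UNIV" "space Q = UNIV" by (simp_all add: P_def Q_def)
  define E where "E = (24 * (\<mu> / (r + 2)) / w\<^sup>2 + 8 * \<alpha> * (\<mu> / (r + 2)) / w) * \<theta>"
  define D where "D = gamma_density_bound r \<alpha> * w powr (min r 1) / min r 1"
  have interval: "cdf Q (y + w) \<le> cdf Q y + D" for y
  proof -
    have "cdf Q (y + w) = measure Q ({..y} \<union> {y<..y + w})"
      unfolding cdf_def using \<open>w > 0\<close> by (intro arg_cong[where f = "measure Q"]) auto
    also have "\<dots> \<le> cdf Q y + measure Q {y<..y + w}"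
      unfolding cdf_def by (rule measure_Un_le) (simp_all add: sets)
    also have "measure Q {y<..y + w} \<le> D"
      unfolding Q_def D_def by (rule Gamma_law_interval_le[OF r_pos \<alpha>_pos \<open>w > 0\<close>])
    finally show ?thesis by simp
  qed
  have step: "\<exists>g. g \<in> borel_measurable borel \<and> (\<forall>x. indicator {..y} x \<le> g x \<and> g x \<le> indicator {..y + w} x)
      \<and> \<bar>(LINT x|P. g x) - (LINT x|Q. g x)\<bar> \<le> E" for y
  proof -
    obtain g g' g'' where g: "\<And>x. (g has_real_derivative g' x) (at x)"
        "\<And>x. (g' has_real_derivative g'' x) (at x)" "continuous_on UNIV g''"
        "\<And>x. \<bar>g' x\<bar> \<le> 2 / w" "\<And>x. \<bar>g'' x\<bar> \<le> 8 / w\<^sup>2"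
      and range: "\<And>x. 0 \<le> g x" "\<And>x. g x \<le> 1"
        "\<And>x. x \<le> y \<Longrightarrow> g x = 1" "\<And>x. x \<ge> y + w \<Longrightarrow> g x = 0"
      using smooth_step[OF \<open>w > 0\<close>, of y] by blast
    have "continuous_on UNIV g"
      using g(1) by (auto intro!: DERIV_continuous_on intro: has_field_derivative_at_within)
    then have [measurable]: "g \<in> borel_measurable borel" by (rule borel_measurable_continuous_onI)
    have "\<bar>(LINT x|P. g x) - (LINT x|Q. g x)\<bar>
        \<le> \<mu> * ((2 * (8 / w\<^sup>2) + 4 * \<alpha> * (2 / w)) / (r + 2) * \<theta>)"
      using stein_bound[OF g] by (simp add: P_def Q_def integral_distr)
    also have "\<dots> = (16 * (\<mu> / (r + 2)) / w\<^sup>2 + 8 * \<alpha> * (\<mu> / (r + 2)) / w) * \<theta>"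
      by (simp add: add_divide_distrib algebra_simps)
    \<comment> \<open>The coefficient \<open>16\<close> is raised to \<open>24\<close>, the value
      for which the minimization over \<open>w\<close> yields the stated constants.\<close>
    also have "\<dots> \<le> E"
      unfolding E_def using \<mu>_pos r_pos \<theta>_nonneg
      by (intro mult_right_mono add_right_mono divide_right_mono) auto
    finally have "\<bar>(LINT x|P. g x) - (LINT x|Q. g x)\<bar> \<le> E" .
    moreover have "indicator {..y} x \<le> g x \<and> g x \<le> indicator {..y + w} x" for x
      using range[of x] \<open>w > 0\<close> by (cases "x \<le> y + w") (auto simp: indicator_def)
    ultimately show ?thesis by (intro exI[of _ g]) auto
  qed
  have between: "cdf R y \<le> (LINT x|R. g x)" "(LINT x|R. g x) \<le> cdf R (y + w)"
    if "prob_space R" "sets R = sets borel" "g \<in> borel_measurable borel"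
      "\<forall>x. indicator {..y} x \<le> g x \<and> g x \<le> indicator {..y + w} x" for R :: "real measure" and g y
  proof -
    interpret R: prob_space R by fact
    have [measurable_cong]: "sets R = sets borel" by fact
    have sp: "space R = UNIV" using sets_eq_imp_space_eq[OF that(2)] by simp
    have gm[measurable]: "g \<in> borel_measurable R" using that(3) by measurable
    have "\<bar>g x\<bar> \<le> 1" for x
    proof -
      have "indicator {..y} x \<ge> (0::real)" "indicator {..y + w} x \<le> (1::real)" by (auto simp: indicator_def)
      then show ?thesis using that(4)[rule_format, of x] by linarith
    qed
    then have g: "integrable R g" by (intro R.integrable_const_bound[of _ 1]) auto
    have ind: "integrable R (indicator {..x} :: real \<Rightarrow> real)" "(LINT u|R. indicator {..x} u) = cdf R x" for x
      by (simp_all add: cdf_def sp R.emeasure_eq_measure)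
    show "cdf R y \<le> (LINT x|R. g x)"
      unfolding ind(2)[symmetric] by (rule integral_mono[OF ind(1) g]) (use that(4) in auto)
    show "(LINT x|R. g x) \<le> cdf R (y + w)"
      unfolding ind(2)[symmetric] by (rule integral_mono[OF g ind(1)]) (use that(4) in auto)
  qed
  have upper: "cdf P z \<le> cdf Q z + D + E"
  proof -
    obtain g where g: "g \<in> borel_measurable borel"
        "\<forall>x. indicator {..z} x \<le> g x \<and> g x \<le> indicator {..z + w} x"
      and "\<bar>(LINT x|P. g x) - (LINT x|Q. g x)\<bar> \<le> E" using step by blast
    then show ?thesis
      using between(1)[OF P.prob_space_axioms sets(1) g] between(2)[OF Q.prob_space_axioms sets(2) g]
        interval[of z] by linarith
  qed
  \<comment> \<open>The step is placed to the left of \<open>z\<close>, from \<open>z - w\<close> to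
    \<open>z\<close>, so that its upper indicator is the one at \<open>z\<close> for the law of
    \<open>W\<close>.\<close>
  have lower: "cdf Q z \<le> cdf P z + D + E"
  proof -
    obtain g where g: "g \<in> borel_measurable borel"
        "\<forall>x. indicator {..z - w} x \<le> g x \<and> g x \<le> indicator {..z - w + w} x"
      and "\<bar>(LINT x|P. g x) - (LINT x|Q. g x)\<bar> \<le> E" using step by blast
    then show ?thesis
      using between(1)[OF Q.prob_space_axioms sets(2) g] between(2)[OF P.prob_space_axioms sets(1) g]
        interval[of "z - w"] by simp
  qed
  show ?thesis
    using upper lower unfolding P_def Q_def D_def E_def by linarith
qed

theorem kolmogorov_bound:
  "kolmogorov_dist (distr M borel W) (Gamma_law r \<alpha>)
     \<le> ennreal (coeff_a \<mu> r \<alpha> * \<theta> powr (min r 1 / (min r 1 + 2))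
          + coeff_b \<mu> r \<alpha> * \<theta> powr ((min r 1 + 1) / (min r 1 + 2)))"
  unfolding kolmogorov_dist_def
proof (intro SUP_least ennreal_leI)
  fix z
  have "\<mu> / (r + 2) > 0" "min r 1 > 0" using \<mu>_pos r_pos by simp_all
  from kolmogorov_optimize[OF this(1) gamma_density_bound_pos[OF r_pos \<alpha>_pos] this(2) \<theta>_nonneg
      cdf_diff_bound]
  show "\<bar>cdf (distr M borel W) z - cdf (Gamma_law r \<alpha>) z\<bar>
      \<le> coeff_a \<mu> r \<alpha> * \<theta> powr (min r 1 / (min r 1 + 2))
          + coeff_b \<mu> r \<alpha> * \<theta> powr ((min r 1 + 1) / (min r 1 + 2))"
    unfolding coeff_a_eq[OF r_pos \<mu>_pos \<alpha>_pos] coeff_b_eq[OF r_pos \<mu>_pos \<alpha>_pos] .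
qed

end

theorem theorem3p1:
  fixes M :: "'a measure" and N1 :: "'b measure" and N2 :: "'c measure"
    and W :: "'a \<Rightarrow> real" and Ws :: "'b \<Rightarrow> real" and Wz :: "'c \<Rightarrow> real"
    and \<mu> \<sigma> \<alpha> r :: real and \<Theta> :: ennreal
  assumes "prob_space M" and "prob_space N1" and "prob_space N2"
    and "W \<in> borel_measurable M" and "Ws \<in> borel_measurable N1" and "Wz \<in> borel_measurable N2"
    and "AE \<omega> in M. 0 \<le> W \<omega>"
    and "integrable M W" and "\<mu> = prob_space.expectation M W"
    and "integrable M (\<lambda>\<omega>. (W \<omega>)\<^sup>2)" and "\<sigma>\<^sup>2 = prob_space.variance M W" and "\<sigma> > 0"
    and "size_biased M W N1 Ws"
    and "zero_biased M W N2 Wz"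
    and "\<alpha> = \<mu> / \<sigma>\<^sup>2" and "r = \<mu>\<^sup>2 / \<sigma>\<^sup>2"
    and "\<Theta> = wasserstein_dist (distr N1 borel Ws) (distr N2 borel Wz)"
  shows "wasserstein_dist (distr M borel W) (Gamma_law r \<alpha>)
           \<le> ennreal (8 * sqrt (3 * \<mu> / (r + 2))) * ennreal_powr \<Theta> (1/2)
             + ennreal (8 * r / (r + 2)) * \<Theta> \<and>
         kolmogorov_dist (distr M borel W) (Gamma_law r \<alpha>)
           \<le> ennreal (coeff_a \<mu> r \<alpha>) * ennreal_powr \<Theta> (min r 1 / (min r 1 + 2))
             + ennreal (coeff_b \<mu> r \<alpha>) * ennreal_powr \<Theta> ((min r 1 + 1) / (min r 1 + 2))"
proof (cases "\<Theta> = \<infinity>")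
  case False
  then obtain \<theta> where \<theta>: "\<Theta> = ennreal \<theta>" "\<theta> \<ge> 0" by (cases \<Theta>) auto
  interpret gamma_biased M N1 N2 W Ws Wz \<mu> \<sigma> \<alpha> r \<theta>
    using assms \<theta> by (intro gamma_biased.intro gamma_biased_axioms.intro) auto
  have powr: "ennreal_powr \<Theta> p = ennreal (\<theta> powr p)" for p
    using \<theta> by (simp add: ennreal_powr_def)
  have combine: "ennreal a * ennreal x + ennreal b * ennreal y = ennreal (a * x + b * y)"
    if "a \<ge> 0" "b \<ge> 0" "x \<ge> 0" "y \<ge> 0" for a b x y
    using that by (simp add: ennreal_mult ennreal_plus)
  have "ennreal (8 * sqrt (3 * \<mu> / (r + 2))) * ennreal_powr \<Theta> (1/2) + ennreal (8 * r / (r + 2)) * \<Theta>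
      = ennreal (8 * sqrt (3 * \<mu> / (r + 2)) * \<theta> powr (1 / 2) + 8 * r / (r + 2) * \<theta>)"
    unfolding powr unfolding \<theta>(1) using \<theta>(2) \<mu>_pos r_pos by (intro combine) auto
  moreover have "coeff_a \<mu> r \<alpha> \<ge> 0" "coeff_b \<mu> r \<alpha> \<ge> 0"
    using r_pos \<alpha>_pos unfolding coeff_a_eq[OF r_pos \<mu>_pos \<alpha>_pos] coeff_b_eq[OF r_pos \<mu>_pos \<alpha>_pos] by simp_all
  then have "ennreal (coeff_a \<mu> r \<alpha>) * ennreal_powr \<Theta> (min r 1 / (min r 1 + 2))
        + ennreal (coeff_b \<mu> r \<alpha>) * ennreal_powr \<Theta> ((min r 1 + 1) / (min r 1 + 2))
      = ennreal (coeff_a \<mu> r \<alpha> * \<theta> powr (min r 1 / (min r 1 + 2))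
        + coeff_b \<mu> r \<alpha> * \<theta> powr ((min r 1 + 1) / (min r 1 + 2)))"
    unfolding powr by (intro combine) auto
  ultimately show ?thesis using wasserstein_bound kolmogorov_bound by simp
next
  case True
  \<comment> \<open>Both right-hand sides are infinite here. Since
    \<open>0 * \<infinity> = 0\<close> in extended arithmetic, this needs the leading coefficients
    to be strictly positive.\<close>
  have pos: "\<mu> > 0" "\<alpha> > 0" "r > 0"
    using prob_space.gamma_parameters_pos[OF assms(1,7-9,11,12,15,16)] by simp_all
  then have "8 * sqrt (3 * \<mu> / (r + 2)) > 0" by simp
  moreover have "coeff_a \<mu> r \<alpha> > 0"
    using pos gamma_density_bound_pos[of r \<alpha>] unfolding coeff_a_eq[OF pos(3,1,2)]
    by (intro mult_pos_pos add_pos_pos) auto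
  moreover have "ennreal c * ennreal_powr \<Theta> p = \<top>" if "c > 0" for c p
    using that True by (simp add: ennreal_powr_def ennreal_mult_top)
  ultimately show ?thesis by (simp only:) simp
qed

end
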